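(* Algebraically closed groups are $\mathfrak{X}^{\mathrm{sep}}$-boundedly acyclic.
   Context: **Algebraically closed groups.** A group $\Gamma$ is algebraically closed if every finite system of equations $f_i(g_1,\dots,g_n;x_1,\dots,x_m)=e$, $1\le i\le k$ (where the $f_i$ are group words in constants $g_1,\dots,g_n\in\Gamma$ and unknowns $x_1,\dots,x_m$), which has a solution in some overgroup $\Lambda\ge\Gamma$, has a solution in $\Gamma$. **Bounded cohomology.** All groups are discrete. A Banach $\Gamma$-module is a real Banach space $E$ with an action of $\Gamma$ by linear isometries. $C^k_b(\Gamma;E)$ is the space of bounded functions $\Gamma^{k+1}\to E$, with the action $(\gamma\cdot f)(\gamma_0,\dots,\gamma_k)=\gamma f(\gamma^{-1}\gamma_0,\dots,\gamma^{-1}\gamma_k)$ and the simplicial coboundary; $H^\bullet_b(\Gamma;E)$ is the cohomology of the complex $C^\bullet_b(\Gamma;E)^\Gamma$ of invariants. $E$ is dual if it is isometrically $\Gamma$-isomorphic to the dual of some Banach $\Gamma$-module (with the contragredient action); separable means norm-separable. A group $\Gamma$ is $\mathfrak{X}^{\mathrm{sep}}$-boundedly acyclic if $H^n_b(\Gamma;E)=0$ for all $n\ge1$ and every separable dual Banach $\Gamma$-module $E$. *)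

theory Defs
  imports "HOL-Analysis.Analysis" "HOL-Algebra.Elementary_Groups"
begin

section \<open>Algebraically closed groups\<close>

datatype 'a letter = Const 'a | Unknown nat

text \<open>The flag attached to a letter says whether that letter is inverted.\<close>

type_synonym 'a group_word = "('a letter \<times> bool) list"

definition group_words :: "('a, 'm) monoid_scheme \<Rightarrow> nat \<Rightarrow> 'a group_word set" where
  "group_words G m = lists ((Const ` carrier G \<union> Unknown ` {..<m}) \<times> UNIV)"

primrec letter_value :: "('a \<Rightarrow> 'b) \<Rightarrow> (nat \<Rightarrow> 'b) \<Rightarrow> 'a letter \<Rightarrow> 'b" where
  "letter_value c x (Const g) = c g"
| "letter_value c x (Unknown i) = x i"

primrec word_value ::
  "('b, 'n) monoid_scheme \<Rightarrow> ('a \<Rightarrow> 'b) \<Rightarrow> (nat \<Rightarrow> 'b) \<Rightarrow> 'a group_word \<Rightarrow> 'b" where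
  "word_value H c x [] = \<one>\<^bsub>H\<^esub>"
| "word_value H c x (p # w) =
     (if snd p then inv\<^bsub>H\<^esub> letter_value c x (fst p) else letter_value c x (fst p))
       \<otimes>\<^bsub>H\<^esub> word_value H c x w"

text \<open>\<open>c\<close> interprets the constants in \<open>H\<close>; only the values \<open>x i\<close> with \<open>i < m\<close> matter.\<close>

definition is_solution ::
  "('b, 'n) monoid_scheme \<Rightarrow> ('a \<Rightarrow> 'b) \<Rightarrow> 'a group_word set \<Rightarrow> nat \<Rightarrow> (nat \<Rightarrow> 'b) \<Rightarrow> bool" where
  "is_solution H c F m x \<longleftrightarrow>
     (\<forall>i<m. x i \<in> carrier H) \<and> (\<forall>w\<in>F. word_value H c x w = \<one>\<^bsub>H\<^esub>)"

definition overgroup ::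
  "('a, 'm) monoid_scheme \<Rightarrow> ('b, 'n) monoid_scheme \<Rightarrow> ('a \<Rightarrow> 'b) \<Rightarrow> bool" where
  "overgroup G H c \<longleftrightarrow> group G \<and> group H \<and> c \<in> mon G H"

text \<open>
  HOL cannot quantify over the type of elements of an overgroup inside a definition, so the
  overgroups below are those carried by the type of group words. This loses nothing: only the
  subgroup generated by the constants and the solution matters, and each of its elements is
  the value of a word. See \<open>solvable_in_group_words\<close> and \<open>algebraically_closed_solution\<close>,
  where the overgroup is carried by an arbitrary type.
\<close>

definition algebraically_closed :: "('a, 'm) monoid_scheme \<Rightarrow> bool" where
  "algebraically_closed G \<longleftrightarrow> group G \<and>
     (\<forall>m F. finite F \<longrightarrow> F \<subseteq> group_words G m \<longrightarrow>
        (\<exists>(H :: 'a group_word monoid) c x. overgroup G H c \<and> is_solution H c F m x) \<longrightarrow>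
        (\<exists>x. is_solution G id F m x))"

lemma letter_value_closed:
  assumes "overgroup G H c" "\<forall>i<m. x i \<in> carrier H" "l \<in> Const ` carrier G \<union> Unknown ` {..<m}"
  shows "letter_value c x l \<in> carrier H"
  using assms by (auto simp: overgroup_def mon_def hom_def)

lemma word_value_closed:
  assumes "overgroup G H c" "\<forall>i<m. x i \<in> carrier H" "w \<in> group_words G m"
  shows "word_value H c x w \<in> carrier H"
proof -
  interpret H: group H using assms(1) by (simp add: overgroup_def)
  show ?thesis
    using assms(3) unfolding group_words_def
  proof (induction w)
    case (Cons p w)
    have "letter_value c x (fst p) \<in> carrier H"
      using Cons by (intro letter_value_closed[OF assms(1,2)]) auto
    then show ?case using Cons by auto
  qed auto
qed

lemma word_value_append:
  assumes "overgroup G H c" "\<forall>i<m. x i \<in> carrier H" "v \<in> group_words G m" "w \<in> group_words G m"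
  shows "word_value H c x (v @ w) = word_value H c x v \<otimes>\<^bsub>H\<^esub> word_value H c x w"
proof -
  interpret H: group H using assms(1) by (simp add: overgroup_def)
  have w: "word_value H c x w \<in> carrier H" by (rule word_value_closed[OF assms(1,2,4)])
  show ?thesis
    using assms(3) unfolding group_words_def
  proof (induction v)
    case Nil
    show ?case using w by simp
  next
    case (Cons p v)
    have "letter_value c x (fst p) \<in> carrier H"
      using Cons by (intro letter_value_closed[OF assms(1,2)]) auto
    moreover have "word_value H c x v \<in> carrier H"
      using Cons by (intro word_value_closed[OF assms(1,2)]) (auto simp: group_words_def)
    ultimately show ?case using Cons w by (simp add: H.m_assoc)
  qed
qed

lemma word_value_inv:
  assumes "overgroup G H c" "\<forall>i<m. x i \<in> carrier H" "w \<in> group_words G m"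
  shows "\<exists>v\<in>group_words G m. word_value H c x v = inv\<^bsub>H\<^esub> word_value H c x w"
proof -
  interpret H: group H using assms(1) by (simp add: overgroup_def)
  show ?thesis
    using assms(3)
  proof (induction w)
    case Nil
    show ?case by (rule bexI[of _ "[]"]) (auto simp: group_words_def)
  next
    case (Cons p w)
    then have w: "w \<in> group_words G m" and p: "fst p \<in> Const ` carrier G \<union> Unknown ` {..<m}"
      by (auto simp: group_words_def)
    obtain v where v: "v \<in> group_words G m" "word_value H c x v = inv\<^bsub>H\<^esub> word_value H c x w"
      using Cons.IH w by blast
    have l: "letter_value c x (fst p) \<in> carrier H"
      by (rule letter_value_closed[OF assms(1,2) p])
    have q: "[(fst p, \<not> snd p)] \<in> group_words G m"
      using p by (auto simp: group_words_def)
    have "v @ [(fst p, \<not> snd p)] \<in> group_words G m"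
      using v q by (auto simp: group_words_def)
    moreover have "word_value H c x (v @ [(fst p, \<not> snd p)]) = inv\<^bsub>H\<^esub> word_value H c x (p # w)"
      using l word_value_closed[OF assms(1,2) w]
      by (simp add: word_value_append[OF assms(1,2) v(1) q] v(2) H.inv_mult_group)
    ultimately show ?case by blast
  qed
qed

lemma word_value_subgroup:
  assumes "overgroup G H c" "\<forall>i<m. x i \<in> carrier H"
  shows "subgroup (word_value H c x ` group_words G m) H"
proof -
  interpret H: group H using assms(1) by (simp add: overgroup_def)
  show ?thesis
  proof (rule H.subgroupI)
    show "word_value H c x ` group_words G m \<subseteq> carrier H"
      using word_value_closed[OF assms] by blast
    have "[] \<in> group_words G m" by (simp add: group_words_def)
    then show "word_value H c x ` group_words G m \<noteq> {}" by blast
  next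
    fix a assume "a \<in> word_value H c x ` group_words G m"
    then obtain w where w: "w \<in> group_words G m" "a = word_value H c x w" by blast
    obtain v where v: "v \<in> group_words G m" "word_value H c x v = inv\<^bsub>H\<^esub> word_value H c x w"
      using word_value_inv[OF assms w(1)] by blast
    show "inv\<^bsub>H\<^esub> a \<in> word_value H c x ` group_words G m"
      by (rule image_eqI[OF _ v(1)]) (simp add: v(2) w(2))
  next
    fix a b assume "a \<in> word_value H c x ` group_words G m" "b \<in> word_value H c x ` group_words G m"
    then obtain v w where vw: "v \<in> group_words G m" "w \<in> group_words G m"
      and ab: "a = word_value H c x v" "b = word_value H c x w" by blast
    have "a \<otimes>\<^bsub>H\<^esub> b = word_value H c x (v @ w)"
      using word_value_append[OF assms vw] ab by simp
    moreover have "v @ w \<in> group_words G m" using vw by (auto simp: group_words_def)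
    ultimately show "a \<otimes>\<^bsub>H\<^esub> b \<in> word_value H c x ` group_words G m" by blast
  qed
qed

lemma solvable_in_group_words:
  fixes G :: "('a, 'm) monoid_scheme" and H :: "('b, 'n) monoid_scheme"
  assumes over: "overgroup G H c" and F: "F \<subseteq> group_words G m" and sol: "is_solution H c F m x"
  shows "\<exists>(H' :: 'a group_word monoid) c' x'. overgroup G H' c' \<and> is_solution H' c' F m x'"
proof -
  interpret H: group H using over by (simp add: overgroup_def)
  have xm: "\<forall>i<m. x i \<in> carrier H" using sol by (simp add: is_solution_def)
  define ev where "ev = word_value H c x"
  define S where "S = ev ` group_words G m"
  define r where "r = inv_into (group_words G m) ev"
  have sub: "subgroup S H" unfolding S_def ev_def by (rule word_value_subgroup[OF over xm])
  interpret S: subgroup S H by (rule sub)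
  have ev_r: "ev (r s) = s" if "s \<in> S" for s
    using that unfolding S_def r_def by (rule f_inv_into_f)
  define H' where
    "H' = \<lparr>carrier = r ` S, monoid.mult = \<lambda>a b. r (ev a \<otimes>\<^bsub>H\<^esub> ev b), one = r \<one>\<^bsub>H\<^esub>\<rparr>"
  have grp: "group H'"
  proof (rule groupI)
    fix a assume "a \<in> carrier H'"
    then obtain s where s: "s \<in> S" "a = r s" by (auto simp: H'_def)
    have "inv\<^bsub>H\<^esub> s \<in> S" using s by simp
    moreover have "inv\<^bsub>H\<^esub> s \<otimes>\<^bsub>H\<^esub> s = \<one>\<^bsub>H\<^esub>" using s by (simp add: S.mem_carrier)
    ultimately show "\<exists>y\<in>carrier H'. y \<otimes>\<^bsub>H'\<^esub> a = \<one>\<^bsub>H'\<^esub>"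
      using s by (intro bexI[of _ "r (inv\<^bsub>H\<^esub> s)"]) (auto simp: H'_def ev_r)
  qed (auto simp: H'_def ev_r S.mem_carrier H.m_assoc)
  have r_inv: "inv\<^bsub>H'\<^esub> r s = r (inv\<^bsub>H\<^esub> s)" if "s \<in> S" for s
    by (rule group.inv_equality[OF grp]) (use that in \<open>auto simp: H'_def ev_r S.mem_carrier\<close>)
  have cS: "c g \<in> S" if "g \<in> carrier G" for g
  proof -
    have "ev [(Const g, False)] = c g"
      using letter_value_closed[OF over xm, of "Const g"] that by (simp add: ev_def)
    moreover have "[(Const g, False)] \<in> group_words G m" using that by (simp add: group_words_def)
    ultimately show ?thesis unfolding S_def by (metis image_eqI)
  qed
  have xS: "x i \<in> S" if "i < m" for i
  proof -
    have "ev [(Unknown i, False)] = x i" using xm that by (simp add: ev_def)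
    moreover have "[(Unknown i, False)] \<in> group_words G m" using that by (simp add: group_words_def)
    ultimately show ?thesis unfolding S_def by (metis image_eqI)
  qed
  have inj_r: "inj_on r S" by (metis ev_r inj_onI)
  have over_r: "overgroup G H' (\<lambda>g. r (c g))"
  proof -
    have "c \<in> hom G H" "inj_on c (carrier G)" "group G" using over by (auto simp: overgroup_def mon_def)
    then show ?thesis
      using grp cS inj_r
      by (auto simp: overgroup_def mon_def hom_def H'_def ev_r inj_on_def)
  qed
  have word_r: "word_value H' (\<lambda>g. r (c g)) (\<lambda>i. r (x i)) w = r (word_value H c x w)"
    if "w \<in> group_words G m" for w
    using that
  proof (induction w)
    case Nil
    show ?case by (simp add: H'_def)
  next
    case (Cons p w)
    then have w: "w \<in> group_words G m" and p: "fst p \<in> Const ` carrier G \<union> Unknown ` {..<m}"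
      by (auto simp: group_words_def)
    have lS: "letter_value c x (fst p) \<in> S" using p cS xS by auto
    have lr: "letter_value (\<lambda>g. r (c g)) (\<lambda>i. r (x i)) (fst p) = r (letter_value c x (fst p))"
      by (cases "fst p") auto
    have wS: "word_value H c x w \<in> S" using w by (simp add: S_def ev_def)
    have mult: "r a \<otimes>\<^bsub>H'\<^esub> r b = r (a \<otimes>\<^bsub>H\<^esub> b)" if "a \<in> S" "b \<in> S" for a b
      using that by (simp add: H'_def ev_r)
    show ?case
      using lS wS by (simp add: Cons.IH[OF w] lr r_inv mult)
  qed
  have "is_solution H' (\<lambda>g. r (c g)) F m (\<lambda>i. r (x i))"
    using sol F word_r xS by (auto simp: is_solution_def H'_def)
  with over_r show ?thesis by blast
qed

corollary algebraically_closed_solution: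
  fixes G :: "('a, 'm) monoid_scheme" and H :: "('b, 'n) monoid_scheme"
  assumes "algebraically_closed G" "finite F" "F \<subseteq> group_words G m"
    and "overgroup G H c" "is_solution H c F m x"
  shows "\<exists>y. is_solution G id F m y"
  using assms solvable_in_group_words[OF assms(4,3,5)] by (auto simp: algebraically_closed_def)


section \<open>Banach modules\<close>

locale banach_module = group G
  for G :: "('a, 'm) monoid_scheme" (structure) +
  fixes act :: "'a \<Rightarrow> 'e::banach \<Rightarrow> 'e"
  assumes act_linear: "g \<in> carrier G \<Longrightarrow> linear (act g)"
    and act_norm: "g \<in> carrier G \<Longrightarrow> norm (act g v) = norm v"
    and act_one: "act \<one> v = v"
    and act_mult: "g \<in> carrier G \<Longrightarrow> h \<in> carrier G \<Longrightarrow> act (g \<otimes> h) v = act g (act h v)"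

definition contragredient ::
  "('a, 'm) monoid_scheme \<Rightarrow> ('a \<Rightarrow> 'f \<Rightarrow> 'f)
     \<Rightarrow> 'a \<Rightarrow> ('f::real_normed_vector \<Rightarrow>\<^sub>L real) \<Rightarrow> ('f \<Rightarrow>\<^sub>L real)" where
  "contragredient G act g \<phi> = Blinfun (\<lambda>v. blinfun_apply \<phi> (act (inv\<^bsub>G\<^esub> g) v))"

lemma (in banach_module) contragredient_apply:
  assumes "g \<in> carrier G"
  shows "blinfun_apply (contragredient G act g \<phi>) v = blinfun_apply \<phi> (act (inv g) v)"
proof -
  have "bounded_linear (act (inv g))"
    using assms act_linear[of "inv g"] act_norm[of "inv g"]
    by (auto simp: bounded_linear_def bounded_linear_axioms_def intro!: exI[of _ 1])
  then have "bounded_linear (\<lambda>v. blinfun_apply \<phi> (act (inv g) v))"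
    by (rule bounded_linear_compose[OF blinfun.bounded_linear_right])
  then show ?thesis by (simp add: contragredient_def bounded_linear_Blinfun_apply)
qed

lemma (in banach_module) banach_module_contragredient:
  "banach_module G (contragredient G act)"
proof (intro banach_module.intro banach_module_axioms.intro)
  show "group G" by (rule group_axioms)
next
  fix g :: 'a and \<phi> :: "'e \<Rightarrow>\<^sub>L real" assume g: "g \<in> carrier G"
  show "linear (contragredient G act g)"
    by (rule linearI) (auto intro!: blinfun_eqI simp: contragredient_apply[OF g] blinfun.add_left blinfun.scaleR_left)
  have le: "norm (contragredient G act h \<psi>) \<le> norm \<psi>" if "h \<in> carrier G" for h and \<psi> :: "'e \<Rightarrow>\<^sub>L real"
  proof (rule norm_blinfun_bound)
    fix v :: 'e
    have "norm (blinfun_apply \<psi> (act (inv h) v)) \<le> norm \<psi> * norm (act (inv h) v)"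
      by (rule norm_blinfun)
    then show "norm (blinfun_apply (contragredient G act h \<psi>) v) \<le> norm \<psi> * norm v"
      using that by (simp add: contragredient_apply act_norm)
  qed simp
  have "contragredient G act (inv g) (contragredient G act g \<phi>) = \<phi>"
    using g by (auto intro!: blinfun_eqI simp: contragredient_apply act_mult[symmetric] act_one)
  then show "norm (contragredient G act g \<phi>) = norm \<phi>"
    using le[OF g, of \<phi>] le[of "inv g" "contragredient G act g \<phi>"] g by simp
next
  fix \<phi> :: "'e \<Rightarrow>\<^sub>L real"
  show "contragredient G act \<one> \<phi> = \<phi>"
    by (auto intro!: blinfun_eqI simp: contragredient_apply act_one)
next
  fix g h and \<phi> :: "'e \<Rightarrow>\<^sub>L real" assume "g \<in> carrier G" "h \<in> carrier G"
  then show "contragredient G act (g \<otimes> h) \<phi> = contragredient G act g (contragredient G act h \<phi>)"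
    by (auto intro!: blinfun_eqI simp: contragredient_apply act_mult inv_mult_group)
qed

text \<open>The predual ranges over the Banach modules carried by the type \<open>'f\<close>.\<close>

definition dual_module ::
  "'f::banach itself \<Rightarrow> ('a, 'm) monoid_scheme \<Rightarrow> ('a \<Rightarrow> 'e::banach \<Rightarrow> 'e) \<Rightarrow> bool" where
  "dual_module _ G act \<longleftrightarrow> banach_module G act \<and>
     (\<exists>(act' :: 'a \<Rightarrow> 'f \<Rightarrow> 'f) (T :: 'e \<Rightarrow> ('f \<Rightarrow>\<^sub>L real)).
        banach_module G act' \<and> linear T \<and> bij T \<and> (\<forall>v. norm (T v) = norm v) \<and>
        (\<forall>g\<in>carrier G. \<forall>v. T (act g v) = contragredient G act' g (T v)))"


section \<open>Bounded cohomology\<close>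

definition tuples :: "('a, 'm) monoid_scheme \<Rightarrow> nat \<Rightarrow> 'a list set" where
  "tuples G k = {xs. length xs = Suc k \<and> set xs \<subseteq> carrier G}"

text \<open>Functions on \<open>tuples G k\<close> are represented by their extension by zero.\<close>

definition bounded_cochains ::
  "('a, 'm) monoid_scheme \<Rightarrow> nat \<Rightarrow> ('a list \<Rightarrow> 'e::real_normed_vector) set" where
  "bounded_cochains G k = {f. bounded (f ` tuples G k) \<and> (\<forall>xs. xs \<notin> tuples G k \<longrightarrow> f xs = 0)}"

definition cochain_act ::
  "('a, 'm) monoid_scheme \<Rightarrow> ('a \<Rightarrow> 'e \<Rightarrow> 'e) \<Rightarrow> nat \<Rightarrow> 'a
     \<Rightarrow> ('a list \<Rightarrow> 'e::real_normed_vector) \<Rightarrow> 'a list \<Rightarrow> 'e" where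
  "cochain_act G act k g f = (\<lambda>xs. if xs \<in> tuples G k
     then act g (f (map (\<lambda>x. inv\<^bsub>G\<^esub> g \<otimes>\<^bsub>G\<^esub> x) xs)) else 0)"

definition omit :: "nat \<Rightarrow> 'a list \<Rightarrow> 'a list" where
  "omit i xs = take i xs @ drop (Suc i) xs"

definition coboundary ::
  "('a, 'm) monoid_scheme \<Rightarrow> nat \<Rightarrow> ('a list \<Rightarrow> 'e::real_normed_vector) \<Rightarrow> 'a list \<Rightarrow> 'e" where
  "coboundary G k f = (\<lambda>xs. if xs \<in> tuples G (Suc k)
     then \<Sum>i\<le>Suc k. (-1) ^ i *\<^sub>R f (omit i xs) else 0)"

definition invariant_cochains ::
  "('a, 'm) monoid_scheme \<Rightarrow> ('a \<Rightarrow> 'e \<Rightarrow> 'e) \<Rightarrow> nat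
     \<Rightarrow> ('a list \<Rightarrow> 'e::real_normed_vector) monoid" where
  "invariant_cochains G act k =
     \<lparr>carrier = {f \<in> bounded_cochains G k. \<forall>g\<in>carrier G. cochain_act G act k g f = f},
      monoid.mult = \<lambda>f h xs. f xs + h xs, one = \<lambda>_. 0\<rparr>"

definition bounded_cocycles ::
  "('a, 'm) monoid_scheme \<Rightarrow> ('a \<Rightarrow> 'e \<Rightarrow> 'e) \<Rightarrow> nat
     \<Rightarrow> ('a list \<Rightarrow> 'e::real_normed_vector) set" where
  "bounded_cocycles G act k =
     kernel (invariant_cochains G act k) (invariant_cochains G act (Suc k)) (coboundary G k)"

primrec bounded_coboundaries ::
  "('a, 'm) monoid_scheme \<Rightarrow> ('a \<Rightarrow> 'e \<Rightarrow> 'e) \<Rightarrow> nat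
     \<Rightarrow> ('a list \<Rightarrow> 'e::real_normed_vector) set" where
  "bounded_coboundaries G act 0 = {\<lambda>_. 0}"
| "bounded_coboundaries G act (Suc k) = coboundary G k ` carrier (invariant_cochains G act k)"

text \<open>Only the additive group of the cohomology space is recorded; this suffices for vanishing.\<close>

definition bounded_cohomology ::
  "('a, 'm) monoid_scheme \<Rightarrow> ('a \<Rightarrow> 'e \<Rightarrow> 'e) \<Rightarrow> nat
     \<Rightarrow> ('a list \<Rightarrow> 'e::real_normed_vector) set monoid" where
  "bounded_cohomology G act n =
     (invariant_cochains G act n)\<lparr>carrier := bounded_cocycles G act n\<rparr>
       Mod bounded_coboundaries G act n"

lemma length_omit: "i < length xs \<Longrightarrow> length (omit i xs) = length xs - 1"
  by (simp add: omit_def)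

lemma omit_omit:
  assumes "i \<le> j" "Suc j < length xs"
  shows "omit j (omit i xs) = omit i (omit (Suc j) xs)"
  using assms by (intro nth_equalityI) (auto simp: omit_def nth_append min_def)

lemma omit_tuples: "xs \<in> tuples G (Suc k) \<Longrightarrow> i \<le> Suc k \<Longrightarrow> omit i xs \<in> tuples G k"
  by (auto simp: tuples_def length_omit omit_def dest: in_set_takeD in_set_dropD)

lemma map_omit: "omit i (map f xs) = map f (omit i xs)"
  by (simp add: omit_def take_map drop_map)

lemma coboundary_coboundary:
  fixes f :: "'a list \<Rightarrow> 'e::real_normed_vector"
  shows "coboundary G (Suc k) (coboundary G k f) = (\<lambda>_. 0)"
proof
  fix xs
  show "coboundary G (Suc k) (coboundary G k f) xs = 0"
  proof (cases "xs \<in> tuples G (Suc (Suc k))")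
    case True
    define t where "t = (\<lambda>(i, j). (-1) ^ (i + j) *\<^sub>R f (omit j (omit i xs)))"
    define P where "P = {..Suc (Suc k)} \<times> {..Suc k}"
    have len: "length xs = Suc (Suc (Suc k))" using True by (simp add: tuples_def)
    have "coboundary G (Suc k) (coboundary G k f) xs =
        (\<Sum>i\<le>Suc (Suc k). (-1) ^ i *\<^sub>R (\<Sum>j\<le>Suc k. (-1) ^ j *\<^sub>R f (omit j (omit i xs))))"
      unfolding coboundary_def using True by (auto simp: omit_tuples simp del: sum.atMost_Suc intro!: sum.cong)
    also have "\<dots> = sum t P"
      by (simp add: t_def P_def sum.cartesian_product scaleR_sum_right power_add del: sum.atMost_Suc)
    also have "\<dots> = sum t {p \<in> P. fst p \<le> snd p} + sum t {p \<in> P. \<not> fst p \<le> snd p}"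
    proof -
      have "finite P" by (simp add: P_def)
      then have "sum t ({p \<in> P. fst p \<le> snd p} \<union> {p \<in> P. \<not> fst p \<le> snd p})
          = sum t {p \<in> P. fst p \<le> snd p} + sum t {p \<in> P. \<not> fst p \<le> snd p}"
        by (intro sum.union_disjoint) auto
      moreover have "{p \<in> P. fst p \<le> snd p} \<union> {p \<in> P. \<not> fst p \<le> snd p} = P" by blast
      ultimately show ?thesis by simp
    qed
    also have "sum t {p \<in> P. fst p \<le> snd p} = (\<Sum>p\<in>{p \<in> P. \<not> fst p \<le> snd p}. - t p)"
      by (rule sum.reindex_bij_witness[of _ "\<lambda>(i, j). (j, i - 1)" "\<lambda>(i, j). (Suc j, i)"])
        (auto simp: P_def t_def omit_omit len add.commute)
    finally show ?thesis by (simp add: sum_negf)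
  qed (simp add: coboundary_def)
qed

lemma tuples_translate:
  assumes "group G" "g \<in> carrier G" "xs \<in> tuples G k"
  shows "map (\<lambda>x. g \<otimes>\<^bsub>G\<^esub> x) xs \<in> tuples G k"
  using assms by (auto simp: tuples_def group.is_monoid intro!: monoid.m_closed)

context banach_module
begin

lemma coboundary_invariant:
  assumes "f \<in> carrier (invariant_cochains G act k)"
  shows "coboundary G k f \<in> carrier (invariant_cochains G act (Suc k))"
proof -
  have f: "bounded (f ` tuples G k)" "\<And>g. g \<in> carrier G \<Longrightarrow> cochain_act G act k g f = f"
    using assms by (auto simp: invariant_cochains_def bounded_cochains_def)
  obtain B where B: "\<And>xs. xs \<in> tuples G k \<Longrightarrow> norm (f xs) \<le> B"
    using f(1) by (auto simp: bounded_iff)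
  have "norm (coboundary G k f xs) \<le> (\<Sum>i\<le>Suc k. B)" if "xs \<in> tuples G (Suc k)" for xs
    unfolding coboundary_def using that
    by (auto intro!: sum_norm_le B omit_tuples simp del: sum.atMost_Suc sum_constant)
  then have "bounded (coboundary G k f ` tuples G (Suc k))"
    by (intro boundedI) auto
  moreover have "cochain_act G act (Suc k) g (coboundary G k f) = coboundary G k f" if g: "g \<in> carrier G" for g
  proof
    fix xs
    show "cochain_act G act (Suc k) g (coboundary G k f) xs = coboundary G k f xs"
    proof (cases "xs \<in> tuples G (Suc k)")
      case True
      interpret linear "act g" by (rule act_linear[OF g])
      have "act g (f (map (\<lambda>x. inv g \<otimes> x) (omit i xs))) = f (omit i xs)" if "i \<le> Suc k" for i
        using fun_cong[OF f(2)[OF g], of "omit i xs"] omit_tuples[OF True that]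
        by (simp add: cochain_act_def)
      then show ?thesis
        using True tuples_translate[OF is_group, of "inv g" xs "Suc k"] g
        by (auto simp: cochain_act_def coboundary_def map_omit sum scaleR simp del: sum.atMost_Suc intro!: sum.cong)
    qed (simp add: cochain_act_def coboundary_def)
  qed
  ultimately show ?thesis
    by (auto simp: invariant_cochains_def bounded_cochains_def coboundary_def)
qed

lemma comm_group_invariant_cochains: "comm_group (invariant_cochains G act k)"
proof (rule comm_groupI)
  fix f h
  assume "f \<in> carrier (invariant_cochains G act k)" "h \<in> carrier (invariant_cochains G act k)"
  then have *: "bounded (f ` tuples G k)" "bounded (h ` tuples G k)"
    "\<forall>xs. xs \<notin> tuples G k \<longrightarrow> f xs = 0" "\<forall>xs. xs \<notin> tuples G k \<longrightarrow> h xs = 0"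
    and inv: "\<And>g. g \<in> carrier G \<Longrightarrow> cochain_act G act k g f = f"
    "\<And>g. g \<in> carrier G \<Longrightarrow> cochain_act G act k g h = h"
    by (auto simp: invariant_cochains_def bounded_cochains_def)
  have "cochain_act G act k g (\<lambda>xs. f xs + h xs) = (\<lambda>xs. f xs + h xs)" if g: "g \<in> carrier G" for g
  proof
    fix xs
    show "cochain_act G act k g (\<lambda>xs. f xs + h xs) xs = f xs + h xs"
      using fun_cong[OF inv(1)[OF g], of xs] fun_cong[OF inv(2)[OF g], of xs] *(3,4)
      by (auto simp: cochain_act_def linear_add[OF act_linear[OF g]] split: if_splits)
  qed
  then show "f \<otimes>\<^bsub>invariant_cochains G act k\<^esub> h \<in> carrier (invariant_cochains G act k)"
    using * by (auto simp: invariant_cochains_def bounded_cochains_def intro!: bounded_plus_comp)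
next
  show "\<one>\<^bsub>invariant_cochains G act k\<^esub> \<in> carrier (invariant_cochains G act k)"
    by (auto simp: invariant_cochains_def bounded_cochains_def cochain_act_def linear_0 act_linear image_constant_conv)
next
  fix f assume f: "f \<in> carrier (invariant_cochains G act k)"
  then have inv: "\<And>g. g \<in> carrier G \<Longrightarrow> cochain_act G act k g f = f"
    and 0: "\<forall>xs. xs \<notin> tuples G k \<longrightarrow> f xs = 0" and b: "bounded (f ` tuples G k)"
    by (auto simp: invariant_cochains_def bounded_cochains_def)
  have "cochain_act G act k g (\<lambda>xs. - f xs) = (\<lambda>xs. - f xs)" if g: "g \<in> carrier G" for g
  proof
    fix xs
    show "cochain_act G act k g (\<lambda>xs. - f xs) xs = - f xs"
      using fun_cong[OF inv[OF g], of xs] 0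
      by (auto simp: cochain_act_def linear_neg[OF act_linear[OF g]] split: if_splits)
  qed
  moreover have "bounded ((\<lambda>xs. - f xs) ` tuples G k)"
    using b by (auto simp: bounded_iff)
  ultimately have "(\<lambda>xs. - f xs) \<in> carrier (invariant_cochains G act k)"
    using 0 by (auto simp: invariant_cochains_def bounded_cochains_def)
  then show "\<exists>h\<in>carrier (invariant_cochains G act k).
      h \<otimes>\<^bsub>invariant_cochains G act k\<^esub> f = \<one>\<^bsub>invariant_cochains G act k\<^esub>"
    by (intro bexI[of _ "\<lambda>xs. - f xs"]) (auto simp: invariant_cochains_def)
qed (auto simp: invariant_cochains_def add_ac)

lemma coboundary_hom:
  "coboundary G k \<in> hom (invariant_cochains G act k) (invariant_cochains G act (Suc k))"
proof (rule homI)
  fix f h :: "'a list \<Rightarrow> 'e"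
  show "coboundary G k (f \<otimes>\<^bsub>invariant_cochains G act k\<^esub> h) =
      coboundary G k f \<otimes>\<^bsub>invariant_cochains G act (Suc k)\<^esub> coboundary G k h"
    by (rule ext) (simp add: coboundary_def invariant_cochains_def scaleR_add_right sum.distrib del: sum.atMost_Suc)
qed (rule coboundary_invariant)

lemma comm_group_bounded_cohomology: "comm_group (bounded_cohomology G act n)"
proof -
  have hom: "group_hom (invariant_cochains G act k) (invariant_cochains G act (Suc k)) (coboundary G k)" for k
    using comm_group_invariant_cochains coboundary_hom
    by (auto simp: group_hom_def group_hom_axioms_def comm_group_def)
  interpret C: comm_group "invariant_cochains G act n" by (rule comm_group_invariant_cochains)
  have Z: "subgroup (bounded_cocycles G act n) (invariant_cochains G act n)"
    unfolding bounded_cocycles_def by (rule group_hom.subgroup_kernel[OF hom])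
  have "subgroup (bounded_coboundaries G act n) (invariant_cochains G act n) \<and>
    bounded_coboundaries G act n \<subseteq> bounded_cocycles G act n"
  proof (cases n)
    case 0
    have "subgroup {\<one>\<^bsub>invariant_cochains G act n\<^esub>} (invariant_cochains G act n)"
      by (rule C.triv_subgroup)
    moreover have "(\<lambda>_. 0) = \<one>\<^bsub>invariant_cochains G act n\<^esub>" by (simp add: invariant_cochains_def)
    ultimately show ?thesis using 0 subgroup.one_closed[OF Z] by auto
  next
    case (Suc k)
    have "subgroup (bounded_coboundaries G act n) (invariant_cochains G act n)"
      using group_hom.img_is_subgroup[OF hom[of k]] Suc by simp
    moreover have "bounded_coboundaries G act n \<subseteq> bounded_cocycles G act n"
      using Suc coboundary_invariant
      by (auto simp: bounded_cocycles_def kernel_def coboundary_coboundary invariant_cochains_def[of _ _ "Suc (Suc k)"])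
    ultimately show ?thesis by blast
  qed
  then have "subgroup (bounded_coboundaries G act n)
      ((invariant_cochains G act n)\<lparr>carrier := bounded_cocycles G act n\<rparr>)"
    using C.subgroup_incl[OF _ Z] by blast
  moreover have "comm_group ((invariant_cochains G act n)\<lparr>carrier := bounded_cocycles G act n\<rparr>)"
    using subgroup.subset[OF Z]
    by (intro group.group_comm_groupI C.subgroup_imp_group Z) (auto intro: C.m_comm)
  ultimately show ?thesis
    unfolding bounded_cohomology_def using comm_group.abelian_FactGroup by blast
qed

end

text \<open>
  The type arguments carry the coefficient modules and their preduals. Quantification over all
  separable dual Banach modules is expressed by leaving both types variable.
\<close>

definition Xsep_boundedly_acyclic ::
  "'e::banach itself \<Rightarrow> 'f::banach itself \<Rightarrow> ('a, 'm) monoid_scheme \<Rightarrow> bool" where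
  "Xsep_boundedly_acyclic _ _ G \<longleftrightarrow>
     (\<forall>act :: 'a \<Rightarrow> 'e \<Rightarrow> 'e.
        dual_module TYPE('f) G act \<longrightarrow> separable_space (euclidean :: 'e topology) \<longrightarrow>
        (\<forall>n\<ge>1. trivial_group (bounded_cohomology G act n)))"

end

theory Submission
  imports Defs "HOL-Probability.Probability_Mass_Function"
begin

text \<open>
  Let \<open>f\<close> be a bounded invariant cocycle and \<open>S\<close> a finite subset of \<open>G\<close>. Since \<open>G\<close> is
  algebraically closed, it contains involutions \<open>t 0, t 1, \<dots>\<close> such that conjugation by \<open>t k\<close>
  makes the group generated by \<open>S\<close> and the previous involutions commute with itself; so \<open>G\<close>
  contains images of \<open>\<langle>S\<rangle> \<wr> W\<close> with \<open>W\<close> finite and arbitrarily large. Averaging \<open>f\<close> over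
  independent random right translates, distributed as a uniform element of \<open>W\<close> times independent
  elements of \<open>S\<close> in all copies of \<open>\<langle>S\<rangle>\<close> except the original one, changes \<open>f\<close> only by a
  coboundary, by the prism operator. In the limit, the average is the first term of a
  martingale that all involutions preserve up to isometries of \<open>E\<close>. As in the ergodic theory
  of Bernoulli shifts, such a martingale is constant when \<open>E\<close> is a separable dual. A
  constant cocycle is the coboundary of a constant, and the primitives obtained for all
  finite \<open>S\<close> have a weak-* cluster point.
\<close>

text \<open>The copy of \<open>S\<close> that the averaging leaves out is filled by the vertices:
  for \<open>y\<close> in \<open>S\<close>, \<open>y\<close> times the random translate is a random
  point of the wreath product conditioned on its first coordinate being \<open>y\<close>. So the
  averaged cocycle on tuples from \<open>S\<close> is a conditional expectation given first
  coordinates, with one independent point per vertex. The uniform element of W absorbs a left factor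
  \<open>t j\<close>, which then merely exchanges two halves of the coordinates; as \<open>f\<close>
  is equivariant, conditioning on either half gives the same values up to an isometry. The distance
  between the values at two independent points is then nearly the same on both halves, hence nearly
  deterministic. Unless the martingale is constant, this distance stays positive, and every ball of
  a fixed small radius loses its mass. The obstacle is that second moments give no norm convergence
  in a Banach space to play against this. They control only finitely many scalar pairings at a time,
  which is enough to keep weak-* limits away from one point of a dense sequence after the
  other.\<close>

section \<open>Finite expectations\<close>

text \<open>All laws in use have finite support, so a finite sum replaces a Bochner integral. On an
  infinite support the sum is 0 by convention, hence the finiteness hypotheses.\<close>

definition mean :: "'w pmf \<Rightarrow> ('w \<Rightarrow> 'b::real_vector) \<Rightarrow> 'b" where
  "mean p h = (\<Sum>a\<in>set_pmf p. pmf p a *\<^sub>R h a)"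

lemma mean_cong: "(\<And>x. x \<in> set_pmf p \<Longrightarrow> h x = h' x) \<Longrightarrow> mean p h = mean p h'"
  by (simp add: mean_def)

lemma mean_return [simp]: "mean (return_pmf x) h = h x"
  by (simp add: mean_def)

lemma mean_superset:
  assumes "finite A" "set_pmf p \<subseteq> A"
  shows "mean p h = (\<Sum>a\<in>A. pmf p a *\<^sub>R h a)"
  unfolding mean_def
  by (rule sum.mono_neutral_left) (use assms in \<open>auto simp: set_pmf_iff\<close>)

lemma mean_bind:
  assumes fin: "finite (set_pmf p)" "\<And>x. x \<in> set_pmf p \<Longrightarrow> finite (set_pmf (q x))"
  shows "mean (bind_pmf p q) h = mean p (\<lambda>x. mean (q x) h)"
proof -
  define A where "A = set_pmf (bind_pmf p q)"
  have A: "finite A" using fin by (simp add: A_def)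
  have "pmf (bind_pmf p q) a = (\<Sum>x\<in>set_pmf p. pmf p x * pmf (q x) a)" for a
    using fin(1) by (simp add: pmf_bind integral_measure_pmf_real[where A = "set_pmf p"] mult.commute)
  then have "mean (bind_pmf p q) h = (\<Sum>a\<in>A. \<Sum>x\<in>set_pmf p. pmf p x *\<^sub>R pmf (q x) a *\<^sub>R h a)"
    by (simp add: mean_def A_def scaleR_sum_left)
  also have "\<dots> = (\<Sum>x\<in>set_pmf p. \<Sum>a\<in>A. pmf p x *\<^sub>R pmf (q x) a *\<^sub>R h a)"
    by (rule sum.swap)
  also have "\<dots> = (\<Sum>x\<in>set_pmf p. pmf p x *\<^sub>R mean (q x) h)"
  proof (rule sum.cong[OF refl])
    fix x assume "x \<in> set_pmf p"
    then have "set_pmf (q x) \<subseteq> A" by (auto simp: A_def)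
    then show "(\<Sum>a\<in>A. pmf p x *\<^sub>R pmf (q x) a *\<^sub>R h a) = pmf p x *\<^sub>R mean (q x) h"
      by (simp add: mean_superset[OF A] scaleR_sum_right)
  qed
  finally show ?thesis by (simp add: mean_def)
qed

lemma mean_map: "finite (set_pmf p) \<Longrightarrow> mean (map_pmf g p) h = mean p (\<lambda>x. h (g x))"
  by (simp add: map_pmf_def mean_bind)

lemma mean_pair:
  "finite (set_pmf p) \<Longrightarrow> finite (set_pmf q) \<Longrightarrow>
     mean (pair_pmf p q) h = mean p (\<lambda>x. mean q (\<lambda>y. h (x, y)))"
  by (simp add: pair_pmf_def mean_bind)

lemma mean_commute: "mean p (\<lambda>x. mean q (\<lambda>y. h x y)) = mean q (\<lambda>y. mean p (\<lambda>x. h x y))"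
  by (subst (1 2) mean_def, subst (1 2) mean_def)
     (simp add: scaleR_sum_right sum.swap[of _ "set_pmf q"] mult.commute)

lemma sum_pmf_set: "finite (set_pmf p) \<Longrightarrow> (\<Sum>a\<in>set_pmf p. pmf p a) = 1"
  by (rule sum_pmf_eq_1) auto

lemma mean_const [simp]: "finite (set_pmf p) \<Longrightarrow> mean p (\<lambda>_. c) = c"
  by (simp add: mean_def sum_pmf_set flip: scaleR_sum_left)

lemma mean_add: "mean p (\<lambda>x. g x + h x) = mean p g + mean p h"
  by (simp add: mean_def scaleR_add_right sum.distrib)

lemma mean_diff: "mean p (\<lambda>x. g x - h x) = mean p g - mean p h"
  by (simp add: mean_def scaleR_diff_right sum_subtractf)

lemma mean_linear: "linear L \<Longrightarrow> L (mean p h) = mean p (\<lambda>x. L (h x))"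
  by (simp add: mean_def linear_sum linear_scale)

lemma mean_sum: "mean p (\<lambda>x. \<Sum>i\<in>I. h i x) = (\<Sum>i\<in>I. mean p (h i))"
  unfolding mean_def scaleR_sum_right by (rule sum.swap)

lemma mean_mult_left: "mean p (\<lambda>x. c * h x) = c * mean p (h :: _ \<Rightarrow> real)"
  by (simp add: mean_def sum_distrib_left mult_ac)

lemma mean_mult_right: "mean p (\<lambda>x. h x * c) = mean p (h :: _ \<Rightarrow> real) * c"
  by (simp add: mean_def sum_distrib_left mult_ac)

lemma mean_divide: "mean p (\<lambda>x. h x / c) = mean p (h :: _ \<Rightarrow> real) / c"
  by (simp add: mean_def sum_divide_distrib)

lemma mean_mono:
  fixes g h :: "'w \<Rightarrow> real"
  shows "(\<And>x. x \<in> set_pmf p \<Longrightarrow> g x \<le> h x) \<Longrightarrow> mean p g \<le> mean p h"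
  by (auto simp: mean_def intro!: sum_mono mult_left_mono)

lemma mean_nonneg: "(\<And>x. x \<in> set_pmf p \<Longrightarrow> 0 \<le> h x) \<Longrightarrow> 0 \<le> mean p (h :: 'w \<Rightarrow> real)"
  by (auto simp: mean_def intro!: sum_nonneg)

lemma mean_ge_point:
  fixes h :: "'w \<Rightarrow> real"
  assumes "finite (set_pmf p)" "x \<in> set_pmf p" "\<And>x. x \<in> set_pmf p \<Longrightarrow> 0 \<le> h x"
  shows "pmf p x * h x \<le> mean p h"
  unfolding mean_def real_scaleR_def
  by (rule member_le_sum[of x _ "\<lambda>a. pmf p a * h a"]) (use assms in auto)

lemma norm_mean_le_mean_norm:
  fixes h :: "'w \<Rightarrow> 'b::real_normed_vector"
  shows "norm (mean p h) \<le> mean p (\<lambda>x. norm (h x))"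
  unfolding mean_def by (rule order_trans[OF norm_sum]) simp

lemma norm_mean_le:
  fixes h :: "'w \<Rightarrow> 'b::real_normed_vector"
  assumes "finite (set_pmf p)" "\<And>x. x \<in> set_pmf p \<Longrightarrow> norm (h x) \<le> C"
  shows "norm (mean p h) \<le> C"
  using order_trans[OF norm_mean_le_mean_norm mean_mono[of p "\<lambda>x. norm (h x)" "\<lambda>_. C"]] assms by simp

lemma mean_tendsto:
  fixes g :: "'i \<Rightarrow> 'w \<Rightarrow> real"
  assumes "\<And>x. ((\<lambda>k. g k x) \<longlongrightarrow> l x) U"
  shows "((\<lambda>k. mean p (g k)) \<longlongrightarrow> mean p l) U"
  unfolding mean_def by (intro tendsto_sum tendsto_scaleR tendsto_const assms)

section \<open>Ultrafilter limits\<close>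

text \<open>Zorn's lemma on the proper filters below \<open>F\<close>: a property is eventual for
  the infimum of a chain only if it is so for a member, hence the infimum is proper. A minimal
  filter decides \<open>P\<close>, since its meet with \<open>{x. P x}\<close> is \<open>bot\<close>
  or the filter itself.\<close>

lemma ex_ultrafilter:
  fixes F :: "'i filter"
  assumes "F \<noteq> bot"
  shows "\<exists>U\<le>F. U \<noteq> bot \<and> (\<forall>P. eventually P U \<or> eventually (\<lambda>x. \<not> P x) U)"
proof -
  define S where "S = {U. U \<le> F \<and> U \<noteq> bot}"
  have chain: "\<exists>u\<in>S. \<forall>a\<in>\<C>. u \<le> a"
    if "\<C> \<in> Chains (relation_of (\<lambda>U V. V \<le> U) S)" for \<C>
  proof (cases "\<C> = {}")
    case True
    then show ?thesis using assms by (auto simp: S_def)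
  next
    case False
    have sub: "\<C> \<subseteq> S" and lin: "\<And>a b. a \<in> \<C> \<Longrightarrow> b \<in> \<C> \<Longrightarrow> a \<le> b \<or> b \<le> a"
      using that by (auto simp: Chains_def relation_of_def)
    have "eventually P (Inf \<C>) \<longleftrightarrow> (\<exists>b\<in>\<C>. eventually P b)" for P
      by (rule eventually_Inf_base[OF False]) (use lin in \<open>metis inf.absorb1 inf.absorb2 order_refl\<close>)
    then have "Inf \<C> \<noteq> bot"
      using sub by (auto simp: trivial_limit_def S_def)
    moreover have "Inf \<C> \<le> F" using False sub by (auto simp: S_def intro: Inf_lower2)
    ultimately have "Inf \<C> \<in> S" by (simp add: S_def)
    then show ?thesis
      by (intro bexI[of _ "Inf \<C>"]) (auto intro: Inf_lower)
  qed
  have "partial_order_on S (relation_of (\<lambda>U V. V \<le> U) S)"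
    by (rule partial_order_on_relation_ofI) auto
  then have "\<exists>U\<in>S. \<forall>V\<in>S. V \<le> U \<longrightarrow> V = U"
    by (rule predicate_Zorn) (rule chain)
  then obtain U where U: "U \<in> S" "\<And>V. V \<in> S \<Longrightarrow> V \<le> U \<Longrightarrow> V = U" by blast
  have "eventually P U \<or> eventually (\<lambda>x. \<not> P x) U" for P
  proof (cases "inf U (principal {x. P x}) = bot")
    case True
    then show ?thesis by (simp add: trivial_limit_def eventually_inf_principal)
  next
    case False
    then have "inf U (principal {x. P x}) = U"
      using U by (auto simp: S_def intro: le_infI1)
    moreover have "eventually P (inf U (principal {x. P x}))"
      by (simp add: eventually_inf_principal)
    ultimately show ?thesis by simp
  qed
  then show ?thesis using U(1) by (auto simp: S_def)
qed

text \<open>Compactness of the interval gives a cluster point, and a cluster point of an ultrafilter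
  is a limit.\<close>

lemma ultrafilter_bounded_convergent:
  fixes a :: "'i \<Rightarrow> real"
  assumes U: "U \<noteq> bot" "\<And>P. eventually P U \<or> eventually (\<lambda>x. \<not> P x) U" and a: "\<And>i. \<bar>a i\<bar> \<le> C"
  shows "\<exists>l. (a \<longlongrightarrow> l) U"
proof -
  have "\<exists>x\<in>{-C..C}. inf (nhds x) (filtermap a U) \<noteq> bot"
    using compact_Icc[of "-C" C] U(1) a unfolding compact_filter
    by (auto simp: filtermap_bot_iff eventually_filtermap abs_le_iff minus_le_iff)
  then obtain x where x: "inf (nhds x) (filtermap a U) \<noteq> bot" by blast
  have "(a \<longlongrightarrow> x) U"
    unfolding tendsto_def
  proof (intro allI impI)
    fix S assume S: "open S" "x \<in> S"
    then have ev: "eventually (\<lambda>y. y \<in> S) (nhds x)" by (rule eventually_nhds_in_open)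
    show "eventually (\<lambda>i. a i \<in> S) U"
    proof (rule ccontr)
      assume "\<not> eventually (\<lambda>i. a i \<in> S) U"
      then have "eventually (\<lambda>y. y \<notin> S) (filtermap a U)"
        using U(2)[of "\<lambda>i. a i \<in> S"] by (simp add: eventually_filtermap)
      with ev have "eventually (\<lambda>_. False) (inf (nhds x) (filtermap a U))"
        unfolding eventually_inf by blast
      with x show False by (simp add: trivial_limit_def)
    qed
  qed
  then show ?thesis ..
qed

section \<open>Martingales in separable duals\<close>

text \<open>Surjectivity of \<open>T\<close> turns pointwise limits of functionals into vectors of
  \<open>'e\<close>, injectivity makes them unique.\<close>

locale isometric_duality =
  fixes T :: "'e::banach \<Rightarrow> ('f::banach \<Rightarrow>\<^sub>L real)"
  assumes linear_T: "linear T" and bij_T: "bij T" and norm_T: "norm (T v) = norm v"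
begin

lemma T_add: "T (u + v) = T u + T v" and T_diff: "T (u - v) = T u - T v"
  by (simp_all add: linear_add linear_diff linear_T)

lemma linear_pairing: "linear (\<lambda>v. blinfun_apply (T v) \<phi>)"
  by (rule linearI) (simp_all add: T_add linear_scale[OF linear_T] blinfun.add_left blinfun.scaleR_left)

lemma pairing_mean: "blinfun_apply (T (mean p h)) \<phi> = mean p (\<lambda>x. blinfun_apply (T (h x)) \<phi>)"
  by (rule mean_linear[OF linear_pairing])

lemma abs_pairing_le: "\<bar>blinfun_apply (T v) \<phi>\<bar> \<le> norm v * norm \<phi>"
  using norm_blinfun[of "T v" \<phi>] by (simp add: norm_T)

text \<open>One-sided bounds suffice because the unit ball is symmetric.\<close>

lemma norm_leI:
  assumes "0 \<le> r" "\<And>\<phi>. norm \<phi> \<le> 1 \<Longrightarrow> blinfun_apply (T v) \<phi> \<le> r"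
  shows "norm v \<le> r"
proof -
  have "norm (T v) \<le> r"
  proof (rule norm_blinfun_bound[OF assms(1)])
    fix \<phi> :: 'f
    show "norm (blinfun_apply (T v) \<phi>) \<le> r * norm \<phi>"
    proof (cases "\<phi> = 0")
      case False
      have "blinfun_apply (T v) (\<phi> /\<^sub>R norm \<phi>) \<le> r" "blinfun_apply (T v) (- (\<phi> /\<^sub>R norm \<phi>)) \<le> r"
        using False by (intro assms(2); simp)+
      then have "\<bar>blinfun_apply (T v) \<phi> / norm \<phi>\<bar> \<le> r"
        by (simp add: blinfun.minus_right blinfun.scaleR_right divide_inverse mult.commute)
      then show ?thesis using False by (simp add: abs_divide divide_le_eq)
    qed simp
  qed
  then show ?thesis by (simp add: norm_T)
qed

lemma weak_star_eqI:
  assumes "\<And>\<phi>. blinfun_apply (T u) \<phi> = blinfun_apply (T v) \<phi>"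
  shows "u = v"
  using blinfun_eqI[of "T u" "T v"] assms bij_T by (auto dest: bij_is_inj injD)

text \<open>Banach-Alaoglu along an ultrafilter: each scalar pairing has a limit, the limits form a
  bounded functional, and \<open>T\<close> is onto.\<close>

lemma weak_star_limit:
  fixes b :: "'i \<Rightarrow> 'e"
  assumes U: "U \<noteq> bot" "\<And>P. eventually P U \<or> eventually (\<lambda>x. \<not> P x) U" and b: "\<And>i. norm (b i) \<le> C"
  shows "\<exists>v. norm v \<le> C \<and> (\<forall>\<phi>. ((\<lambda>i. blinfun_apply (T (b i)) \<phi>) \<longlongrightarrow> blinfun_apply (T v) \<phi>) U)"
proof -
  have C: "0 \<le> C" using order_trans[OF norm_ge_zero b] .
  have bd: "\<bar>blinfun_apply (T (b i)) \<phi>\<bar> \<le> C * norm \<phi>" for i \<phi>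
    by (rule order_trans[OF abs_pairing_le mult_right_mono[OF b]]) simp
  then have "\<exists>l. ((\<lambda>i. blinfun_apply (T (b i)) \<phi>) \<longlongrightarrow> l) U" for \<phi>
    by (rule ultrafilter_bounded_convergent[OF U])
  then obtain L where L: "\<And>\<phi>. ((\<lambda>i. blinfun_apply (T (b i)) \<phi>) \<longlongrightarrow> L \<phi>) U" by metis
  have "bounded_linear L"
  proof (rule bounded_linear_intro[of _ C])
    fix \<phi> \<psi> :: 'f and r :: real
    show "L (\<phi> + \<psi>) = L \<phi> + L \<psi>"
      using tendsto_unique[OF U(1) L[of "\<phi> + \<psi>"]] tendsto_add[OF L[of \<phi>] L[of \<psi>]]
      by (simp add: blinfun.add_right)
    show "L (r *\<^sub>R \<phi>) = r *\<^sub>R L \<phi>"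
      using tendsto_unique[OF U(1) L[of "r *\<^sub>R \<phi>"]] tendsto_scaleR[OF tendsto_const L[of \<phi>]]
      by (simp add: blinfun.scaleR_right)
    show "norm (L \<phi>) \<le> norm \<phi> * C"
      using tendsto_upperbound[OF tendsto_rabs[OF L[of \<phi>]] _ U(1), of "C * norm \<phi>"] bd
      by (simp add: mult.commute)
  qed
  then have "blinfun_apply (Blinfun L) = L" by (rule bounded_linear_Blinfun_apply)
  moreover obtain v where "T v = Blinfun L" using bij_T by (metis bij_pointE)
  ultimately have v: "blinfun_apply (T v) \<phi> = L \<phi>" for \<phi> by simp
  have "norm v \<le> C"
  proof (rule norm_leI[OF C])
    fix \<phi> :: 'f assume "norm \<phi> \<le> 1"
    then have "blinfun_apply (T (b i)) \<phi> \<le> C" for i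
      using bd[of i \<phi>] mult_left_mono[OF _ C, of "norm \<phi>" 1] by simp
    then show "blinfun_apply (T v) \<phi> \<le> C"
      using tendsto_upperbound[OF L[of \<phi>] _ U(1)] by (simp add: v)
  qed
  then show ?thesis using L v by auto
qed

end

text \<open>
  A bounded vector-valued martingale \<open>M\<close> whose \<open>k\<close>-th level has \<open>2 ^ k\<close> independent
  coordinates, split into two halves by \<open>pr\<close>; \<open>right\<close> says that the conditional expectation
  on the second half is an isometric copy of the one on the first half.
\<close>

locale self_similar_martingale = isometric_duality T
  for T :: "'e::banach \<Rightarrow> ('f::banach \<Rightarrow>\<^sub>L real)" +
  fixes \<mu> :: "nat \<Rightarrow> 'w pmf" and pr :: "'w \<Rightarrow> 'w \<Rightarrow> 'w" and M :: "nat \<Rightarrow> 'w \<Rightarrow> 'e" and C :: real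
  assumes finite_\<mu>_0: "finite (set_pmf (\<mu> 0))"
    and \<mu>_Suc: "\<mu> (Suc k) = bind_pmf (\<mu> k) (\<lambda>x. map_pmf (pr x) (\<mu> k))"
    and norm_M: "norm (M k x) \<le> C"
    and left: "x \<in> set_pmf (\<mu> k) \<Longrightarrow> mean (\<mu> k) (\<lambda>z. M (Suc k) (pr x z)) = M k x"
    and right: "z \<in> set_pmf (\<mu> k) \<Longrightarrow> w \<in> set_pmf (\<mu> k) \<Longrightarrow>
      norm (mean (\<mu> k) (\<lambda>x. M (Suc k) (pr x z)) - mean (\<mu> k) (\<lambda>x. M (Suc k) (pr x w)))
        = norm (M k z - M k w)"
begin

section \<open>Distances between independent samples\<close>

lemma finite_\<mu> [simp]: "finite (set_pmf (\<mu> k))"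
  by (induction k) (simp_all add: finite_\<mu>_0 \<mu>_Suc)

lemma mean_\<mu>_Suc: "mean (\<mu> (Suc k)) h = mean (\<mu> k) (\<lambda>x. mean (\<mu> k) (\<lambda>z. h (pr x z)))"
  by (simp add: \<mu>_Suc mean_bind mean_map)

text \<open>In a Hilbert space this would be twice the variance; in a Banach space distances of
  independent samples take its place.\<close>

definition spread :: "nat \<Rightarrow> real" where
  "spread k = mean (\<mu> k) (\<lambda>x. mean (\<mu> k) (\<lambda>y. (norm (M k x - M k y))\<^sup>2))"

lemma C_nonneg: "0 \<le> C"
  using order_trans[OF norm_ge_zero norm_M] .

lemma norm_diff_le: "norm (M k x - M k y) \<le> 2 * C"
  using norm_triangle_ineq4[of "M k x" "M k y"] norm_M[of k x] norm_M[of k y] by linarith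

lemma spread_le: "spread k \<le> (2 * C)\<^sup>2"
proof -
  have "(norm (M k x - M k y))\<^sup>2 \<le> (2 * C)\<^sup>2" for x y
    by (rule power_mono[OF norm_diff_le]) simp
  then have "spread k \<le> mean (\<mu> k) (\<lambda>x. mean (\<mu> k) (\<lambda>y. (2 * C)\<^sup>2))"
    unfolding spread_def by (intro mean_mono)
  then show ?thesis by simp
qed

abbreviation mean4 :: "nat \<Rightarrow> ('w \<Rightarrow> 'w \<Rightarrow> 'w \<Rightarrow> 'w \<Rightarrow> real) \<Rightarrow> real" where
  "mean4 k h \<equiv> mean (\<mu> k) (\<lambda>x. mean (\<mu> k) (\<lambda>y. mean (\<mu> k) (\<lambda>z. mean (\<mu> k) (\<lambda>w. h x y z w))))"

text \<open>A variance formula in which Jensen's inequality \<open>a \<le> mean p X\<close> replaces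
  equality; \<open>0 \<le> a\<close> gives the cross term the right sign.\<close>

lemma mean_square_diff_le:
  fixes X :: "'x \<Rightarrow> real"
  assumes "finite (set_pmf p)" "0 \<le> a" "a \<le> mean p X"
  shows "mean p (\<lambda>w. (X w - a)\<^sup>2) \<le> mean p (\<lambda>w. (X w)\<^sup>2) - a\<^sup>2"
proof -
  have "(\<lambda>w. (X w - a)\<^sup>2) = (\<lambda>w. (X w)\<^sup>2 - (2 * a) * X w + a\<^sup>2)"
    by (simp add: power2_diff algebra_simps)
  then have "mean p (\<lambda>w. (X w - a)\<^sup>2) = mean p (\<lambda>w. (X w)\<^sup>2) - 2 * a * mean p X + a\<^sup>2"
    using assms(1) by (simp only: mean_diff mean_add mean_mult_left mean_const)
  moreover have "a * a \<le> a * mean p X" using assms by (intro mult_left_mono)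
  ultimately show ?thesis by (simp add: power2_eq_square)
qed

text \<open>Passing to the next level changes neither \<open>D\<close> on the first nor on the second pair
  by much, although these two are independent: so \<open>D\<close> is nearly constant.\<close>

lemma spread_concentration:
  defines "D \<equiv> \<lambda>k x y. norm (M k x - M k y)"
  shows "mean4 k (\<lambda>x y z w. (D k x y - D k z w)\<^sup>2) \<le> 4 * (spread (Suc k) - spread k)"
proof -
  define X where "X = (\<lambda>x y z w. D (Suc k) (pr x z) (pr y w))"
  let ?p = "pair_pmf (\<mu> k) (\<mu> k)"
  have pp: "mean (\<mu> k) (\<lambda>z. mean (\<mu> k) (\<lambda>w. h z w)) = mean ?p (\<lambda>(z, w). h z w)" for h :: "'w \<Rightarrow> 'w \<Rightarrow> 'b::real_vector"
    by (simp add: mean_pair)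
  have swap: "mean4 k h = mean (\<mu> k) (\<lambda>z. mean (\<mu> k) (\<lambda>w. mean (\<mu> k) (\<lambda>x. mean (\<mu> k) (\<lambda>y. h x y z w))))" for h
    using mean_commute[where p = ?p and q = ?p and h = "\<lambda>a b. h (fst a) (snd a) (fst b) (snd b)"]
    by (simp add: mean_pair)
  have S: "mean4 k (\<lambda>x y z w. (X x y z w)\<^sup>2) = spread (Suc k)"
    unfolding spread_def mean_\<mu>_Suc X_def D_def
    by (rule mean_cong, rule mean_commute)
  have 1: "mean4 k (\<lambda>x y z w. (X x y z w - D k x y)\<^sup>2) \<le> spread (Suc k) - spread k"
  proof -
    have "mean (\<mu> k) (\<lambda>z. mean (\<mu> k) (\<lambda>w. (X x y z w - D k x y)\<^sup>2))
        \<le> mean (\<mu> k) (\<lambda>z. mean (\<mu> k) (\<lambda>w. (X x y z w)\<^sup>2)) - (D k x y)\<^sup>2"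
      if "x \<in> set_pmf (\<mu> k)" "y \<in> set_pmf (\<mu> k)" for x y
    proof -
      \<comment> \<open>By \<open>left\<close>, averaging out the second halves leaves the
        difference at level \<open>k\<close>; Jensen then bounds its norm by the mean of
        \<open>X\<close>.\<close>
      have "mean ?p (\<lambda>(z, w). M (Suc k) (pr x z) - M (Suc k) (pr y w)) = M k x - M k y"
        unfolding pp[symmetric] by (simp add: mean_diff left that)
      then have "D k x y \<le> mean ?p (\<lambda>(z, w). X x y z w)"
        using norm_mean_le_mean_norm[of ?p "\<lambda>(z, w). M (Suc k) (pr x z) - M (Suc k) (pr y w)"]
        by (simp add: D_def X_def case_prod_unfold)
      then show ?thesis
        using mean_square_diff_le[of ?p "D k x y" "\<lambda>(z, w). X x y z w"]
        by (simp add: pp case_prod_unfold D_def)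
    qed
    then have "mean4 k (\<lambda>x y z w. (X x y z w - D k x y)\<^sup>2) \<le> mean (\<mu> k) (\<lambda>x. mean (\<mu> k) (\<lambda>y.
        mean (\<mu> k) (\<lambda>z. mean (\<mu> k) (\<lambda>w. (X x y z w)\<^sup>2)) - (D k x y)\<^sup>2))"
      by (intro mean_mono)
    also have "\<dots> = spread (Suc k) - spread k"
      by (simp only: mean_diff S) (simp only: spread_def D_def)
    finally show ?thesis .
  qed
  have 2: "mean4 k (\<lambda>x y z w. (X x y z w - D k z w)\<^sup>2) \<le> spread (Suc k) - spread k"
  proof -
    have "mean (\<mu> k) (\<lambda>x. mean (\<mu> k) (\<lambda>y. (X x y z w - D k z w)\<^sup>2))
        \<le> mean (\<mu> k) (\<lambda>x. mean (\<mu> k) (\<lambda>y. (X x y z w)\<^sup>2)) - (D k z w)\<^sup>2"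
      if "z \<in> set_pmf (\<mu> k)" "w \<in> set_pmf (\<mu> k)" for z w
    proof -
      \<comment> \<open>With the first halves averaged out, \<open>right\<close> recovers the
        difference only up to an isometry, which its norm does not see.\<close>
      have "norm (mean ?p (\<lambda>(x, y). M (Suc k) (pr x z) - M (Suc k) (pr y w))) = D k z w"
        unfolding pp[symmetric] by (simp add: mean_diff right that D_def)
      then have "D k z w \<le> mean ?p (\<lambda>(x, y). X x y z w)"
        using norm_mean_le_mean_norm[of ?p "\<lambda>(x, y). M (Suc k) (pr x z) - M (Suc k) (pr y w)"]
        by (simp add: D_def X_def case_prod_unfold)
      then show ?thesis
        using mean_square_diff_le[of ?p "D k z w" "\<lambda>(x, y). X x y z w"]
        by (simp add: pp case_prod_unfold D_def)
    qed
    then have "mean (\<mu> k) (\<lambda>z. mean (\<mu> k) (\<lambda>w. mean (\<mu> k) (\<lambda>x. mean (\<mu> k) (\<lambda>y. (X x y z w - D k z w)\<^sup>2))))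
      \<le> mean (\<mu> k) (\<lambda>z. mean (\<mu> k) (\<lambda>w.
        mean (\<mu> k) (\<lambda>x. mean (\<mu> k) (\<lambda>y. (X x y z w)\<^sup>2)) - (D k z w)\<^sup>2))"
      by (intro mean_mono)
    also have "\<dots> = mean4 k (\<lambda>x y z w. (X x y z w)\<^sup>2) - spread k"
      unfolding swap[of "\<lambda>x y z w. (X x y z w)\<^sup>2"] spread_def D_def by (simp only: mean_diff)
    finally show ?thesis
      unfolding S swap[of "\<lambda>x y z w. (X x y z w - D k z w)\<^sup>2"] .
  qed
  \<comment> \<open>Both distances are compared with \<open>X\<close> by the inequality
    \<open>(a + b)^2 \<le> 2 * a^2 + 2 * b^2\<close>.\<close>
  have "(D k x y - D k z w)\<^sup>2 \<le> 2 * (X x y z w - D k x y)\<^sup>2 + 2 * (X x y z w - D k z w)\<^sup>2" for x y z w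
    using sum_squares_bound[of "X x y z w - D k x y" "D k z w - X x y z w"]
    by (simp add: power2_eq_square algebra_simps)
  then have "mean4 k (\<lambda>x y z w. (D k x y - D k z w)\<^sup>2)
      \<le> mean4 k (\<lambda>x y z w. 2 * (X x y z w - D k x y)\<^sup>2 + 2 * (X x y z w - D k z w)\<^sup>2)"
    by (intro mean_mono)
  also have "\<dots> = 2 * mean4 k (\<lambda>x y z w. (X x y z w - D k x y)\<^sup>2)
      + 2 * mean4 k (\<lambda>x y z w. (X x y z w - D k z w)\<^sup>2)"
    by (simp add: mean_add mean_mult_left)
  also have "\<dots> \<le> 2 * (spread (Suc k) - spread k) + 2 * (spread (Suc k) - spread k)"
    using 1 2 by (intro add_mono mult_left_mono) simp_all
  finally show ?thesis by simp
qed

text \<open>The increments bound a mean of squares from above, so they are nonnegative.\<close>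

lemma spread_mono: "incseq spread"
proof (rule incseq_SucI)
  fix k
  have "0 \<le> mean4 k (\<lambda>x y z w. (norm (M k x - M k y) - norm (M k z - M k w))\<^sup>2)"
    by (intro mean_nonneg) simp
  from order_trans[OF this spread_concentration] show "spread k \<le> spread (Suc k)" by simp
qed

text \<open>The increments of the bounded increasing \<open>spread\<close> tend to 0, so the
  distance of two samples concentrates. As \<open>spread k\<close> stays above
  \<open>spread 0\<close>, distances of at least \<open>2 * r\<close> keep a fixed probability
  \<open>q\<close>; hence those below \<open>r\<close> must lose theirs.\<close>

lemma small_ball:
  assumes xy: "x \<in> set_pmf (\<mu> 0)" "y \<in> set_pmf (\<mu> 0)" "M 0 x \<noteq> M 0 y"
  shows "\<exists>r>0. \<forall>e. (\<lambda>k. mean (\<mu> k) (\<lambda>x. of_bool (norm (M k x - e) < r) :: real)) \<longlonglongrightarrow> 0"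
proof -
  have "0 < pmf (\<mu> 0) x * (pmf (\<mu> 0) y * (norm (M 0 x - M 0 y))\<^sup>2)"
    using xy by (auto simp: pmf_positive)
  also have "\<dots> \<le> pmf (\<mu> 0) x * mean (\<mu> 0) (\<lambda>y. (norm (M 0 x - M 0 y))\<^sup>2)"
    using xy by (intro mult_left_mono mean_ge_point) auto
  also have "\<dots> \<le> spread 0"
    unfolding spread_def using xy by (intro mean_ge_point mean_nonneg) auto
  finally have s0: "0 < spread 0" .
  then have Cpos: "0 < C" using spread_le[of 0] C_nonneg by (cases "C = 0") auto
  \<comment> \<open>Pairs closer than \<open>2 * r\<close> contribute at most
    \<open>4 * r^2\<close>, half of \<open>spread 0\<close>. The other half comes from distances of
    at most \<open>2 * C\<close>, so these pairs have probability at least \<open>q\<close>.\<close>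
  define r where "r = sqrt (spread 0 / 8)"
  have r: "0 < r" "r\<^sup>2 = spread 0 / 8" using s0 by (auto simp: r_def)
  define q where "q = spread 0 / (8 * C\<^sup>2)"
  have q: "0 < q" using s0 Cpos by (simp add: q_def)
  define D where "D = (\<lambda>k x y. norm (M k x - M k y))"
  define far :: "nat \<Rightarrow> real" where "far k = mean (\<mu> k) (\<lambda>z. mean (\<mu> k) (\<lambda>w. of_bool (2 * r \<le> D k z w)))" for k
  define near :: "nat \<Rightarrow> real" where "near k = mean (\<mu> k) (\<lambda>x. mean (\<mu> k) (\<lambda>y. of_bool (D k x y < r)))" for k
  have far: "q \<le> far k" for k
  proof -
    have pt: "(D k z w)\<^sup>2 \<le> 4 * r\<^sup>2 + 4 * C\<^sup>2 * of_bool (2 * r \<le> D k z w)" for z w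
    proof (cases "2 * r \<le> D k z w")
      case True
      have "(D k z w)\<^sup>2 \<le> (2 * C)\<^sup>2" by (rule power_mono) (auto simp: D_def norm_diff_le)
      then show ?thesis using True by (simp add: power_mult_distrib add_increasing)
    next
      case False
      then have "(D k z w)\<^sup>2 \<le> (2 * r)\<^sup>2" by (intro power_mono) (auto simp: D_def)
      then show ?thesis using False by (simp add: power_mult_distrib)
    qed
    have "spread 0 \<le> spread k" using spread_mono by (simp add: incseq_def)
    also have "\<dots> \<le> mean (\<mu> k) (\<lambda>z. mean (\<mu> k) (\<lambda>w. 4 * r\<^sup>2 + 4 * C\<^sup>2 * of_bool (2 * r \<le> D k z w)))"
      unfolding spread_def using pt by (intro mean_mono) (simp add: D_def)
    also have "\<dots> = 4 * r\<^sup>2 + 4 * C\<^sup>2 * far k"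
      by (simp add: mean_add mean_mult_left far_def)
    finally have "spread 0 / 2 \<le> 4 * C\<^sup>2 * far k" using r(2) by simp
    then show ?thesis using Cpos by (simp add: q_def field_simps)
  qed
  have near_le: "near k \<le> 4 / (q * r\<^sup>2) * (spread (Suc k) - spread k)" for k
  proof -
    have pt: "r\<^sup>2 * (of_bool (D k x y < r) * of_bool (2 * r \<le> D k z w)) \<le> (D k x y - D k z w)\<^sup>2" for x y z w
    proof (cases "D k x y < r \<and> 2 * r \<le> D k z w")
      case True
      then have "r\<^sup>2 \<le> (D k z w - D k x y)\<^sup>2" using r(1) by (intro power_mono) auto
      then show ?thesis using True by (simp add: power2_commute)
    qed auto
    have "near k * q * r\<^sup>2 \<le> r\<^sup>2 * (near k * far k)"
    proof -
      have "0 \<le> near k" unfolding near_def by (intro mean_nonneg) simp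
      then have "near k * q \<le> near k * far k" using far by (intro mult_left_mono)
      then have "near k * q * r\<^sup>2 \<le> near k * far k * r\<^sup>2" by (rule mult_right_mono) simp
      then show ?thesis by (simp add: mult_ac)
    qed
    \<comment> \<open>The near pair and the far pair are independent, so the product of their
      probabilities is one fourfold mean.\<close>
    also have "\<dots> = mean4 k (\<lambda>x y z w. r\<^sup>2 * (of_bool (D k x y < r) * of_bool (2 * r \<le> D k z w)))"
    proof -
      have "near k * c = mean (\<mu> k) (\<lambda>x. mean (\<mu> k) (\<lambda>y. of_bool (D k x y < r) * c))" for c
        by (simp add: near_def mean_mult_right)
      then have "near k * far k = mean (\<mu> k) (\<lambda>x. mean (\<mu> k) (\<lambda>y. of_bool (D k x y < r) * far k))" .
      then show ?thesis by (simp add: far_def mean_mult_left)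
    qed
    also have "\<dots> \<le> mean4 k (\<lambda>x y z w. (D k x y - D k z w)\<^sup>2)"
      using pt by (intro mean_mono)
    also have "\<dots> \<le> 4 * (spread (Suc k) - spread k)"
      unfolding D_def by (rule spread_concentration)
    finally show ?thesis using q r(1) by (simp add: field_simps)
  qed
  have "bdd_above (range spread)" using spread_le by (auto intro!: bdd_aboveI2)
  then have l: "spread \<longlonglongrightarrow> (SUP k. spread k)" (is "_ \<longlonglongrightarrow> ?l")
    by (rule LIMSEQ_incseq_SUP[OF _ spread_mono])
  have "(\<lambda>k. 4 / (q * r\<^sup>2) * (spread (Suc k) - spread k)) \<longlonglongrightarrow> 4 / (q * r\<^sup>2) * (?l - ?l)"
    by (intro tendsto_intros l LIMSEQ_Suc)
  then have lim0: "(\<lambda>k. 4 / (q * r\<^sup>2) * (spread (Suc k) - spread k)) \<longlonglongrightarrow> 0" by simp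
  have near0: "near \<longlonglongrightarrow> 0"
  proof (rule tendsto_sandwich[OF _ _ tendsto_const lim0])
    show "eventually (\<lambda>k. 0 \<le> near k) sequentially" by (simp add: near_def mean_nonneg)
    show "eventually (\<lambda>k. near k \<le> 4 / (q * r\<^sup>2) * (spread (Suc k) - spread k)) sequentially"
      by (intro always_eventually allI near_le)
  qed
  have "(\<lambda>k. mean (\<mu> k) (\<lambda>x. of_bool (norm (M k x - e) < r / 2) :: real)) \<longlonglongrightarrow> 0" (is "?p \<longlonglongrightarrow> 0") for e
  proof -
    \<comment> \<open>The square is the probability that two independent samples both lie in the
      ball of radius \<open>r / 2\<close>; they are then less than \<open>r\<close> apart.\<close>
    have "(?p k)\<^sup>2 \<le> near k" for k
    proof -
      have "(?p k)\<^sup>2 = mean (\<mu> k) (\<lambda>x. mean (\<mu> k) (\<lambda>y. of_bool (norm (M k x - e) < r / 2) * of_bool (norm (M k y - e) < r / 2)))"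
        by (simp add: power2_eq_square mean_mult_left mean_mult_right)
      also have "\<dots> \<le> near k"
        unfolding near_def
      proof (intro mean_mono)
        fix x y
        have "norm (M k x - M k y) \<le> norm (M k x - e) + norm (M k y - e)"
          using norm_triangle_ineq4[of "M k x - e" "M k y - e"] by simp
        then show "(of_bool (norm (M k x - e) < r / 2) * of_bool (norm (M k y - e) < r / 2) :: real) \<le> of_bool (D k x y < r)"
          by (auto simp: D_def)
      qed
      finally show ?thesis .
    qed
    then have "(\<lambda>k. (?p k)\<^sup>2) \<longlonglongrightarrow> 0"
      by (intro tendsto_sandwich[OF _ _ tendsto_const near0]) auto
    then show ?thesis by (simp add: power_tendsto_0_iff)
  qed
  then show ?thesis using r(1) by (intro exI[of _ "r / 2"]) auto
qed

section \<open>Conditional laws and weak-* constraints\<close>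

primrec descendants :: "nat \<Rightarrow> nat \<Rightarrow> 'w \<Rightarrow> 'w pmf" where
  "descendants m 0 s = return_pmf s"
| "descendants m (Suc j) s = bind_pmf (descendants m j s) (\<lambda>x. map_pmf (pr x) (\<mu> (m + j)))"

lemma finite_descendants [simp]: "finite (set_pmf (descendants m j s))"
  by (induction j) simp_all

text \<open>This identifies \<open>descendants m j s\<close> as the conditional law at level
  \<open>m + j\<close> given the ancestor \<open>s\<close> at level \<open>m\<close>.\<close>

lemma \<mu>_descendants: "\<mu> (m + j) = bind_pmf (\<mu> m) (descendants m j)"
  by (induction j) (simp_all add: bind_return_pmf' \<mu>_Suc bind_assoc_pmf)

lemma mean_descendants: "mean (\<mu> (m + j)) h = mean (\<mu> m) (\<lambda>s. mean (descendants m j s) h)"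
  by (simp add: \<mu>_descendants mean_bind)

lemma descendants_martingale:
  assumes "s \<in> set_pmf (\<mu> m)"
  shows "mean (descendants m j s) (M (m + j)) = M m s"
proof (induction j)
  case (Suc j)
  have "set_pmf (descendants m j s) \<subseteq> set_pmf (\<mu> (m + j))"
    using assms by (auto simp: \<mu>_descendants)
  then have "mean (descendants m (Suc j) s) (M (m + Suc j)) = mean (descendants m j s) (M (m + j))"
    by (auto simp: mean_bind mean_map left intro!: mean_cong)
  then show ?case using Suc by simp
qed simp

text \<open>Each pair in \<open>\<Gamma>\<close> imposes a weak-* closed half-space. A probability
  bounded below at infinitely many levels, rather than a single value satisfying all constraints,
  survives the removal of a small ball when the next constraint is added.\<close>

definition frequently_above :: "('f \<times> 'e) set \<Rightarrow> real \<Rightarrow> bool" where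
  "frequently_above \<Gamma> \<theta> \<longleftrightarrow> (\<exists>\<delta>>0::real. \<exists>\<^sub>F m in sequentially.
     \<delta> \<le> mean (\<mu> m) (\<lambda>x. of_bool (\<forall>(\<phi>, e)\<in>\<Gamma>. \<theta> \<le> blinfun_apply (T (M m x - e)) \<phi>)))"

text \<open>The pairings with finitely many functionals are bounded scalar martingales; their second
  moments converge even where \<open>M\<close> has no norm limit.\<close>

definition energy :: "('f \<times> 'e) set \<Rightarrow> nat \<Rightarrow> real" where
  "energy \<Gamma> m = mean (\<mu> m) (\<lambda>x. \<Sum>(\<phi>, e)\<in>\<Gamma>. (blinfun_apply (T (M m x)) \<phi>)\<^sup>2)"

definition deviation :: "('f \<times> 'e) set \<Rightarrow> nat \<Rightarrow> nat \<Rightarrow> 'w \<Rightarrow> 'w \<Rightarrow> real" where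
  "deviation \<Gamma> m j s x = (\<Sum>(\<phi>, e)\<in>\<Gamma>. (blinfun_apply (T (M (m + j) x)) \<phi> - blinfun_apply (T (M m s)) \<phi>)\<^sup>2)"

text \<open>Orthogonality of martingale increments, applied to each pairing separately.\<close>

lemma mean_deviation:
  "mean (\<mu> m) (\<lambda>s. mean (descendants m j s) (deviation \<Gamma> m j s)) = energy \<Gamma> (m + j) - energy \<Gamma> m"
proof -
  define v where "v = (\<lambda>m x \<phi>. blinfun_apply (T (M m x)) \<phi>)"
  have 1: "mean (descendants m j s) (\<lambda>x. (v (m + j) x \<phi> - v m s \<phi>)\<^sup>2)
      = mean (descendants m j s) (\<lambda>x. (v (m + j) x \<phi>)\<^sup>2) - (v m s \<phi>)\<^sup>2"
    if "s \<in> set_pmf (\<mu> m)" for s \<phi>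
  proof -
    have "mean (descendants m j s) (\<lambda>x. v (m + j) x \<phi>) = v m s \<phi>"
      by (simp add: v_def descendants_martingale[OF that] flip: pairing_mean)
    moreover have "(\<lambda>x. (v (m + j) x \<phi> - v m s \<phi>)\<^sup>2)
        = (\<lambda>x. (v (m + j) x \<phi>)\<^sup>2 - (2 * v m s \<phi>) * v (m + j) x \<phi> + (v m s \<phi>)\<^sup>2)"
      by (simp add: power2_diff algebra_simps)
    ultimately show ?thesis
      by (simp add: mean_add mean_diff mean_mult_left power2_eq_square)
  qed
  have "mean (\<mu> m) (\<lambda>s. mean (descendants m j s) (deviation \<Gamma> m j s))
      = mean (\<mu> m) (\<lambda>s. mean (descendants m j s) (\<lambda>x. \<Sum>(\<phi>, e)\<in>\<Gamma>. (v (m + j) x \<phi>)\<^sup>2) - (\<Sum>(\<phi>, e)\<in>\<Gamma>. (v m s \<phi>)\<^sup>2))"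
    unfolding deviation_def
    by (rule mean_cong) (simp add: case_prod_unfold mean_sum sum_subtractf[symmetric] 1[unfolded v_def] v_def)
  then show ?thesis
    by (simp add: mean_diff energy_def mean_descendants v_def)
qed

lemma incseq_energy: "incseq (energy \<Gamma>)"
proof (rule incseq_SucI)
  fix m
  have "0 \<le> mean (\<mu> m) (\<lambda>s. mean (descendants m 1 s) (deviation \<Gamma> m 1 s))"
    by (intro mean_nonneg) (auto simp: deviation_def intro!: sum_nonneg)
  then show "energy \<Gamma> m \<le> energy \<Gamma> (Suc m)" unfolding mean_deviation by simp
qed

lemma energy_le: "energy \<Gamma> m \<le> (\<Sum>(\<phi>, e)\<in>\<Gamma>. (C * norm \<phi>)\<^sup>2)"
proof -
  have "\<bar>blinfun_apply (T (M m x)) \<phi>\<bar> \<le> \<bar>C * norm \<phi>\<bar>" for x \<phi>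
    using order_trans[OF abs_pairing_le mult_right_mono[OF norm_M[of m x] norm_ge_zero]] C_nonneg by simp
  then have "(\<Sum>(\<phi>, e)\<in>\<Gamma>. (blinfun_apply (T (M m x)) \<phi>)\<^sup>2) \<le> (\<Sum>(\<phi>, e)\<in>\<Gamma>. (C * norm \<phi>)\<^sup>2)" for x
    by (auto intro!: sum_mono simp: abs_le_square_iff)
  then have "energy \<Gamma> m \<le> mean (\<mu> m) (\<lambda>_. \<Sum>(\<phi>, e)\<in>\<Gamma>. (C * norm \<phi>)\<^sup>2)"
    unfolding energy_def by (rule mean_mono)
  then show ?thesis by simp
qed

lemma energy_cauchy:
  assumes "0 < \<zeta>"
  shows "\<exists>m0. \<forall>m\<ge>m0. \<forall>j. energy \<Gamma> (m + j) - energy \<Gamma> m \<le> \<zeta>"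
proof -
  have "bdd_above (range (energy \<Gamma>))" using energy_le by (auto intro!: bdd_aboveI2)
  then have l: "energy \<Gamma> \<longlonglongrightarrow> (SUP m. energy \<Gamma> m)"
    by (rule LIMSEQ_incseq_SUP[OF _ incseq_energy])
  then have "eventually (\<lambda>m. (SUP m. energy \<Gamma> m) - \<zeta> < energy \<Gamma> m) sequentially"
    using assms by (intro order_tendstoD(1)) auto
  then obtain m0 where m0: "\<And>m. m \<ge> m0 \<Longrightarrow> (SUP m. energy \<Gamma> m) - \<zeta> < energy \<Gamma> m"
    by (auto simp: eventually_sequentially)
  have "energy \<Gamma> (m + j) - energy \<Gamma> m \<le> \<zeta>" if "m \<ge> m0" for m j
    using m0[OF that] incseq_le[OF incseq_energy l, of "m + j"] by linarith
  then show ?thesis by blast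
qed

text \<open>An ancestor \<open>s\<close> that meets the old constraints and has \<open>M m s\<close>
  outside the ball around \<open>e\<close> supplies a functional separating \<open>M m s\<close>
  from \<open>e\<close>. Given \<open>s\<close>, the new pairing keeps its conditional mean at all
  later levels, while the old pairings hardly move by Chebyshev's inequality; so old and new
  constraints hold together with positive probability.\<close>

lemma frequently_above_insert:
  assumes ball: "\<And>e. (\<lambda>k. mean (\<mu> k) (\<lambda>x. of_bool (norm (M k x - e) < r) :: real)) \<longlonglongrightarrow> 0"
    and r: "0 < r" and fin: "finite \<Gamma>" and \<theta>: "r / 8 < \<theta>" "frequently_above \<Gamma> \<theta>"
  shows "\<exists>\<phi>. norm \<phi> \<le> 1 \<and> (\<exists>\<theta>'>r / 8. frequently_above (insert (\<phi>, e) \<Gamma>) \<theta>')"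
proof -
  define B where "B = C + norm e + 1"
  have B: "0 < B" using C_nonneg by (simp add: B_def add_nonneg_pos)
  \<comment> \<open>A quantity bounded by \<open>B\<close> with mean above \<open>r / 2\<close> is
    at least \<open>r / 4\<close> with probability at least \<open>p1\<close>.\<close>
  define p1 where "p1 = r / 4 / B"
  have p1: "0 < p1" using r B by (simp add: p1_def)
  \<comment> \<open>Each insertion may lower the threshold, but halving its excess over
    \<open>r / 8\<close> keeps it above that value.\<close>
  define \<theta>1 where "\<theta>1 = (\<theta> + r / 8) / 2"
  have \<theta>1: "r / 8 < \<theta>1" "\<theta>1 < \<theta>" using \<theta>(1) by (auto simp: \<theta>1_def field_simps)
  define \<theta>' where "\<theta>' = min \<theta>1 (r / 4)"
  have \<theta>': "r / 8 < \<theta>'" using \<theta>1 r by (simp add: \<theta>'_def)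
  \<comment> \<open>This mean square deviation lets an old pairing drop below
    \<open>\<theta>1\<close> with probability at most \<open>p1 / 2\<close>, half of what the new
    constraint has.\<close>
  define \<kappa> where "\<kappa> = p1 * (\<theta> - \<theta>1)\<^sup>2 / 2"
  have \<kappa>: "0 < \<kappa>" using p1 \<theta>1 by (simp add: \<kappa>_def)
  define good where "good = (\<lambda>\<Gamma> t m x. \<forall>(\<phi>, e)\<in>\<Gamma>. t \<le> blinfun_apply (T (M m x - e)) \<phi>)"
  obtain \<delta> :: real where \<delta>: "0 < \<delta>" "\<exists>\<^sub>F m in sequentially. \<delta> \<le> mean (\<mu> m) (\<lambda>x. of_bool (good \<Gamma> \<theta> m x))"
    using \<theta>(2) unfolding frequently_above_def good_def by blast
  obtain m0 where m0: "\<And>m j. m \<ge> m0 \<Longrightarrow> energy \<Gamma> (m + j) - energy \<Gamma> m \<le> \<kappa> * \<delta> / 4"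
    using energy_cauchy[of "\<kappa> * \<delta> / 4" \<Gamma>] \<kappa> \<delta>(1) by auto
  have "eventually (\<lambda>m. mean (\<mu> m) (\<lambda>x. of_bool (norm (M m x - e) < r)) < \<delta> / 4 \<and> m \<ge> m0) sequentially"
    using order_tendstoD(2)[OF ball, of "\<delta> / 4"] \<delta>(1) by (auto intro: eventually_conj eventually_ge_at_top)
  then obtain m where m: "\<delta> \<le> mean (\<mu> m) (\<lambda>x. of_bool (good \<Gamma> \<theta> m x))"
      "mean (\<mu> m) (\<lambda>x. of_bool (norm (M m x - e) < r)) < \<delta> / 4" "m \<ge> m0"
    using frequently_ex[OF frequently_eventually_conj[OF \<delta>(2)]] by blast
  define w where "w = (\<lambda>j s. mean (descendants m j s) (deviation \<Gamma> m j s))"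
  have w0: "0 \<le> w j s" for j s
    unfolding w_def deviation_def by (intro mean_nonneg sum_nonneg) auto
  \<comment> \<open>Less than \<open>\<delta> / 4\<close> of the mass lies in the ball, and by
    Markov's inequality at most \<open>\<delta> / 4\<close> has \<open>w j s > \<kappa>\<close>;
    mass at least \<open>\<delta>\<close> is good.\<close>
  have ex: "\<exists>s\<in>set_pmf (\<mu> m). good \<Gamma> \<theta> m s \<and> r \<le> norm (M m s - e) \<and> w j s \<le> \<kappa>" for j
  proof (rule ccontr)
    assume no: "\<not> ?thesis"
    have "of_bool (good \<Gamma> \<theta> m s) \<le> of_bool (norm (M m s - e) < r) + w j s / \<kappa>" if "s \<in> set_pmf (\<mu> m)" for s
      using no that w0[of j s] \<kappa> by (auto simp: le_divide_eq not_le)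
    then have "mean (\<mu> m) (\<lambda>s. of_bool (good \<Gamma> \<theta> m s))
        \<le> mean (\<mu> m) (\<lambda>s. of_bool (norm (M m s - e) < r) + w j s / \<kappa>)"
      by (rule mean_mono)
    also have "\<dots> = mean (\<mu> m) (\<lambda>s. of_bool (norm (M m s - e) < r)) + (energy \<Gamma> (m + j) - energy \<Gamma> m) / \<kappa>"
      by (simp add: mean_add mean_divide w_def mean_deviation)
    also have "\<dots> < \<delta> / 4 + (\<kappa> * \<delta> / 4) / \<kappa>"
      using m(2) m0[OF m(3), of j] \<kappa> by (intro add_less_le_mono divide_right_mono) auto
    finally show False using m(1) \<delta>(1) \<kappa> by simp
  qed
  let ?Q = "\<lambda>j s. good \<Gamma> \<theta> m s \<and> r \<le> norm (M m s - e) \<and> w j s \<le> \<kappa>"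
  \<comment> \<open>The ancestor found above depends on \<open>j\<close>. Since the support is
    finite, one ancestor serves infinitely many \<open>j\<close>, so that \<open>\<phi>\<close> can
    be chosen independently of \<open>j\<close>.\<close>
  have "\<exists>s\<in>set_pmf (\<mu> m). \<exists>\<^sub>F j in sequentially. ?Q j s"
  proof (rule ccontr)
    assume "\<not> ?thesis"
    then have "\<forall>s\<in>set_pmf (\<mu> m). eventually (\<lambda>j. \<not> ?Q j s) sequentially"
      by (simp only: not_frequently bex_simps ball_simps)
    then have "eventually (\<lambda>j. \<forall>s\<in>set_pmf (\<mu> m). \<not> ?Q j s) sequentially"
      by (rule eventually_ball_finite[OF finite_\<mu>])
    then show False using ex by (auto simp: eventually_sequentially)
  qed
  then obtain s where s0: "s \<in> set_pmf (\<mu> m)" and freqs: "\<exists>\<^sub>F j in sequentially. ?Q j s" by blast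
  have s: "s \<in> set_pmf (\<mu> m)" "good \<Gamma> \<theta> m s" "r \<le> norm (M m s - e)"
    using s0 frequently_ex[OF freqs] by auto
  have freq: "\<exists>\<^sub>F j in sequentially. w j s \<le> \<kappa>"
    using freqs by (rule frequently_elim1) simp
  have "\<not> norm (M m s - e) \<le> r / 2" using s(3) r by simp
  then have "\<not> (\<forall>\<phi>. norm \<phi> \<le> 1 \<longrightarrow> blinfun_apply (T (M m s - e)) \<phi> \<le> r / 2)"
    using norm_leI[of "r / 2" "M m s - e"] r by auto
  then obtain \<phi> where \<phi>: "norm \<phi> \<le> 1" "r / 2 < blinfun_apply (T (M m s - e)) \<phi>"
    by (auto simp: not_le)
  have step: "pmf (\<mu> m) s * (p1 / 2) \<le> mean (\<mu> (m + j)) (\<lambda>x. of_bool (good (insert (\<phi>, e) \<Gamma>) \<theta>' (m + j) x))"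
    if wj: "w j s \<le> \<kappa>" for j
  proof -
    let ?\<kappa> = "descendants m j s"
    define val where "val = (\<lambda>x. blinfun_apply (T (M (m + j) x - e)) \<phi>)"
    have "val x \<le> r / 4 + B * of_bool (r / 4 \<le> val x)" for x
    proof -
      have "val x \<le> norm (M (m + j) x - e) * norm \<phi>"
        using abs_pairing_le[of "M (m + j) x - e" \<phi>] by (simp add: val_def)
      also have "\<dots> \<le> norm (M (m + j) x - e)" using \<phi>(1) by (simp add: mult_left_le)
      also have "\<dots> \<le> B"
        using norm_triangle_ineq4[of "M (m + j) x" e] norm_M[of "m + j" x] by (simp add: B_def)
      finally show ?thesis using r by (auto simp: not_le)
    qed
    then have "mean ?\<kappa> val \<le> mean ?\<kappa> (\<lambda>x. r / 4 + B * of_bool (r / 4 \<le> val x))"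
      by (rule mean_mono)
    moreover have "mean ?\<kappa> val = blinfun_apply (T (M m s - e)) \<phi>"
      unfolding val_def pairing_mean[symmetric] by (simp add: mean_diff descendants_martingale[OF s(1)])
    ultimately have "r / 4 \<le> B * mean ?\<kappa> (\<lambda>x. of_bool (r / 4 \<le> val x))"
      using \<phi>(2) by (simp add: mean_add mean_mult_left)
    then have large: "p1 \<le> mean ?\<kappa> (\<lambda>x. of_bool (r / 4 \<le> val x))"
      using B by (simp add: p1_def field_simps)
    have "of_bool (r / 4 \<le> val x) \<le> of_bool (good (insert (\<phi>, e) \<Gamma>) \<theta>' (m + j) x)
        + deviation \<Gamma> m j s x / (\<theta> - \<theta>1)\<^sup>2" for x
    proof -
      have dev: "0 \<le> deviation \<Gamma> m j s x" unfolding deviation_def by (intro sum_nonneg) auto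
      have "(\<theta> - \<theta>1)\<^sup>2 \<le> deviation \<Gamma> m j s x"
        if bad: "r / 4 \<le> val x" "\<not> good (insert (\<phi>, e) \<Gamma>) \<theta>' (m + j) x"
      proof -
        obtain \<psi> d where d: "(\<psi>, d) \<in> \<Gamma>" "blinfun_apply (T (M (m + j) x - d)) \<psi> < \<theta>'"
          using bad by (auto simp: good_def val_def \<theta>'_def not_le)
        moreover have "\<theta> \<le> blinfun_apply (T (M m s - d)) \<psi>"
          using s(2) d(1) by (auto simp: good_def)
        ultimately have "\<theta> - \<theta>1 \<le> blinfun_apply (T (M m s)) \<psi> - blinfun_apply (T (M (m + j) x)) \<psi>"
          by (simp add: T_diff blinfun.diff_left \<theta>'_def)
        then have "(\<theta> - \<theta>1)\<^sup>2 \<le> (blinfun_apply (T (M m s)) \<psi> - blinfun_apply (T (M (m + j) x)) \<psi>)\<^sup>2"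
          using \<theta>1 by (intro power_mono) auto
        also have "\<dots> = (\<lambda>(\<phi>, e). (blinfun_apply (T (M (m + j) x)) \<phi> - blinfun_apply (T (M m s)) \<phi>)\<^sup>2) (\<psi>, d)"
          by (simp add: power2_commute)
        also have "\<dots> \<le> deviation \<Gamma> m j s x"
          unfolding deviation_def by (rule member_le_sum[OF d(1) _ fin]) auto
        finally show ?thesis .
      qed
      then show ?thesis using dev \<theta>1 by (auto simp: le_divide_eq)
    qed
    then have "mean ?\<kappa> (\<lambda>x. of_bool (r / 4 \<le> val x))
        \<le> mean ?\<kappa> (\<lambda>x. of_bool (good (insert (\<phi>, e) \<Gamma>) \<theta>' (m + j) x) + deviation \<Gamma> m j s x / (\<theta> - \<theta>1)\<^sup>2)"
      by (rule mean_mono)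
    also have "\<dots> = mean ?\<kappa> (\<lambda>x. of_bool (good (insert (\<phi>, e) \<Gamma>) \<theta>' (m + j) x)) + w j s / (\<theta> - \<theta>1)\<^sup>2"
      by (simp add: mean_add mean_divide w_def)
    also have "w j s / (\<theta> - \<theta>1)\<^sup>2 \<le> p1 / 2"
      using wj \<theta>1 by (simp add: \<kappa>_def divide_le_eq)
    finally have "p1 / 2 \<le> mean ?\<kappa> (\<lambda>x. of_bool (good (insert (\<phi>, e) \<Gamma>) \<theta>' (m + j) x))"
      using large by simp
    then have "pmf (\<mu> m) s * (p1 / 2) \<le> pmf (\<mu> m) s * mean ?\<kappa> (\<lambda>x. of_bool (good (insert (\<phi>, e) \<Gamma>) \<theta>' (m + j) x))"
      by (rule mult_left_mono) simp
    also have "\<dots> \<le> mean (\<mu> m) (\<lambda>s. mean (descendants m j s) (\<lambda>x. of_bool (good (insert (\<phi>, e) \<Gamma>) \<theta>' (m + j) x)))"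
      by (rule mean_ge_point[OF finite_\<mu> s(1)]) (intro mean_nonneg, simp)
    finally show ?thesis by (simp only: mean_descendants)
  qed
  have "\<exists>\<^sub>F k in sequentially. pmf (\<mu> m) s * (p1 / 2) \<le> mean (\<mu> k) (\<lambda>x. of_bool (good (insert (\<phi>, e) \<Gamma>) \<theta>' k x))"
    unfolding frequently_sequentially
  proof
    fix N
    obtain j where "j \<ge> N" "w j s \<le> \<kappa>" using freq unfolding frequently_sequentially by blast
    then show "\<exists>k\<ge>N. pmf (\<mu> m) s * (p1 / 2) \<le> mean (\<mu> k) (\<lambda>x. of_bool (good (insert (\<phi>, e) \<Gamma>) \<theta>' k x))"
      using step by (intro exI[of _ "m + j"]) auto
  qed
  moreover have "0 < pmf (\<mu> m) s * (p1 / 2)" using s(1) p1 by (simp add: pmf_positive)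
  ultimately have "frequently_above (insert (\<phi>, e) \<Gamma>) \<theta>'"
    unfolding frequently_above_def good_def by blast
  then show ?thesis using \<phi>(1) \<theta>' by blast
qed

text \<open>A non-constant \<open>M\<close> would have a weak-* cluster value far away from each point of a
  countable dense set.\<close>

theorem constant_if_separable:
  fixes d :: "nat \<Rightarrow> 'e"
  assumes dense: "closure (range d) = UNIV" and xy: "x \<in> set_pmf (\<mu> 0)" "y \<in> set_pmf (\<mu> 0)"
  shows "M 0 x = M 0 y"
proof (rule ccontr)
  assume "M 0 x \<noteq> M 0 y"
  then obtain r where r: "0 < r"
    and ball: "\<And>e. (\<lambda>k. mean (\<mu> k) (\<lambda>x. of_bool (norm (M k x - e) < r) :: real)) \<longlonglongrightarrow> 0"
    using small_ball[OF xy] by blast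
  \<comment> \<open>The thresholds may decrease with \<open>i\<close>, but their common bound
    \<open>r / 8\<close> is the distance that passes to the weak-* limit.\<close>
  define P where "P = (\<lambda>i \<Gamma>. finite \<Gamma> \<and> (\<forall>j<i. \<exists>\<phi>. norm \<phi> \<le> 1 \<and> (\<phi>, d j) \<in> \<Gamma>) \<and> (\<exists>\<theta>>r / 8. frequently_above \<Gamma> \<theta>))"
  have "\<exists>\<Gamma>. \<forall>i. P i (\<Gamma> i) \<and> \<Gamma> i \<subseteq> \<Gamma> (Suc i)"
  proof (rule dependent_nat_choice)
    have "frequently_above {} r"
      unfolding frequently_above_def by (auto intro!: exI[of _ 1] simp: frequently_const_iff)
    then show "\<exists>\<Gamma>. P 0 \<Gamma>" using r by (intro exI[of _ "{}"]) (auto simp: P_def intro!: exI[of _ r])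
  next
    fix \<Gamma> i assume \<Gamma>: "P i \<Gamma>"
    then obtain \<theta> where "finite \<Gamma>" "r / 8 < \<theta>" "frequently_above \<Gamma> \<theta>" by (auto simp: P_def)
    then obtain \<phi> where "norm \<phi> \<le> 1" "\<exists>\<theta>'>r / 8. frequently_above (insert (\<phi>, d i) \<Gamma>) \<theta>'"
      using frequently_above_insert[OF ball r] by blast
    then show "\<exists>\<Gamma>'. P (Suc i) \<Gamma>' \<and> \<Gamma> \<subseteq> \<Gamma>'"
      using \<Gamma> by (intro exI[of _ "insert (\<phi>, d i) \<Gamma>"]) (auto simp: P_def less_Suc_eq)
  qed
  then obtain \<Gamma> where \<Gamma>: "\<And>i. P i (\<Gamma> i)" and \<Gamma>_Suc: "\<And>i. \<Gamma> i \<subseteq> \<Gamma> (Suc i)" by blast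
  have mono: "i \<le> j \<Longrightarrow> \<Gamma> i \<subseteq> \<Gamma> j" for i j by (rule lift_Suc_mono_le[of \<Gamma>, OF \<Gamma>_Suc])
  have "\<exists>u. norm u \<le> C \<and> (\<forall>(\<phi>, e)\<in>\<Gamma> i. r / 8 \<le> blinfun_apply (T (u - e)) \<phi>)" for i
  proof -
    obtain \<theta> \<delta> :: real where \<theta>: "r / 8 < \<theta>" and \<delta>: "0 < \<delta>" "\<exists>\<^sub>F m in sequentially. \<delta> \<le> mean (\<mu> m)
        (\<lambda>x. of_bool (\<forall>(\<phi>, e)\<in>\<Gamma> i. \<theta> \<le> blinfun_apply (T (M m x - e)) \<phi>))"
      using \<Gamma>[of i] by (auto simp: P_def frequently_above_def)
    obtain m where "\<delta> \<le> mean (\<mu> m) (\<lambda>x. of_bool (\<forall>(\<phi>, e)\<in>\<Gamma> i. \<theta> \<le> blinfun_apply (T (M m x - e)) \<phi>))"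
      using frequently_ex[OF \<delta>(2)] by blast
    then obtain x where "\<forall>(\<phi>, e)\<in>\<Gamma> i. \<theta> \<le> blinfun_apply (T (M m x - e)) \<phi>"
      using mean_mono[of "\<mu> m" "\<lambda>x. of_bool (\<forall>(\<phi>, e)\<in>\<Gamma> i. \<theta> \<le> blinfun_apply (T (M m x - e)) \<phi>)" "\<lambda>_. 0"] \<delta>(1)
      by fastforce
    then show ?thesis using norm_M[of m x] \<theta> by (intro exI[of _ "M m x"]) fastforce
  qed
  then obtain u where u: "\<And>i. norm (u i) \<le> C"
    "\<And>i \<phi> e. (\<phi>, e) \<in> \<Gamma> i \<Longrightarrow> r / 8 \<le> blinfun_apply (T (u i - e)) \<phi>" by (metis case_prodD)
  obtain U :: "nat filter" where U: "U \<le> sequentially" "U \<noteq> bot"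
    "\<And>P. eventually P U \<or> eventually (\<lambda>x. \<not> P x) U"
    using ex_ultrafilter[of sequentially] by auto
  obtain v where v: "\<And>\<phi>. ((\<lambda>i. blinfun_apply (T (u i)) \<phi>) \<longlongrightarrow> blinfun_apply (T v) \<phi>) U"
    using weak_star_limit[where b = u, OF U(2,3) u(1)] by blast
  have "r / 8 \<le> norm (v - d j)" for j
  proof -
    obtain \<phi> where \<phi>: "norm \<phi> \<le> 1" "(\<phi>, d j) \<in> \<Gamma> (Suc j)" using \<Gamma>[of "Suc j"] by (auto simp: P_def)
    have "eventually (\<lambda>i. r / 8 \<le> blinfun_apply (T (u i)) \<phi> - blinfun_apply (T (d j)) \<phi>) sequentially"
      using eventually_ge_at_top[of "Suc j"]
    proof eventually_elim
      case (elim i)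
      then show ?case using u(2)[of \<phi> "d j" i] mono[OF elim] \<phi>(2) by (auto simp: T_diff blinfun.diff_left)
    qed
    then have "r / 8 \<le> blinfun_apply (T v) \<phi> - blinfun_apply (T (d j)) \<phi>"
      by (intro tendsto_lowerbound[OF tendsto_diff[OF v tendsto_const] filter_leD[OF U(1)] U(2)])
    also have "\<dots> \<le> norm (v - d j) * norm \<phi>"
      using abs_pairing_le[of "v - d j" \<phi>] by (simp add: T_diff blinfun.diff_left)
    also have "\<dots> \<le> norm (v - d j)" using \<phi>(1) by (simp add: mult_left_le)
    finally show ?thesis .
  qed
  moreover have "v \<in> closure (range d)" using dense by simp
  then obtain j where "dist (d j) v < r / 8"
    using r unfolding closure_approachable by (auto dest: spec[of _ "r / 8"])
  ultimately show False by (metis dist_commute dist_norm not_le)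
qed

end

section \<open>Commuting involutions\<close>

text \<open>The overgroup acts on two copies of \<open>G\<close>: \<open>G\<close> by left translation of the first copy,
  and the new element by swapping both copies.\<close>

lemma algebraically_closed_commuting_involution:
  fixes G :: "('a, 'm) monoid_scheme"
  assumes ac: "algebraically_closed G" and A: "finite A" "A \<subseteq> carrier G"
  shows "\<exists>t\<in>carrier G. t \<otimes>\<^bsub>G\<^esub> t = \<one>\<^bsub>G\<^esub> \<and>
    (\<forall>a\<in>A. \<forall>b\<in>A. a \<otimes>\<^bsub>G\<^esub> (t \<otimes>\<^bsub>G\<^esub> b \<otimes>\<^bsub>G\<^esub> t) = t \<otimes>\<^bsub>G\<^esub> b \<otimes>\<^bsub>G\<^esub> t \<otimes>\<^bsub>G\<^esub> a)"
proof -
  interpret G: group G using ac by (simp add: algebraically_closed_def)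
  define H :: "('a \<times> bool \<Rightarrow> 'a \<times> bool) monoid"
    where "H = \<lparr>carrier = {f. bij f}, monoid.mult = (\<circ>), one = id\<rparr>"
  \<comment> \<open>Fixing the points outside \<open>carrier G\<close> makes \<open>c g\<close> a
    permutation of the whole type.\<close>
  define c where "c = (\<lambda>g (x, b). if \<not> b \<and> x \<in> carrier G then (g \<otimes>\<^bsub>G\<^esub> x, b) else (x, b))"
  define s :: "'a \<times> bool \<Rightarrow> 'a \<times> bool" where "s = (\<lambda>(x, b). (x, \<not> b))"
  have H: "group H"
  proof (rule groupI)
    fix f assume "f \<in> carrier H"
    then show "\<exists>h\<in>carrier H. h \<otimes>\<^bsub>H\<^esub> f = \<one>\<^bsub>H\<^esub>"
      by (intro bexI[of _ "inv_into UNIV f"]) (auto simp: H_def bij_imp_bij_inv bij_is_inj inv_o_cancel)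
  qed (auto simp: H_def bij_comp comp_assoc)
  interpret H: group H by (rule H)
  have c_mult: "c (g \<otimes>\<^bsub>G\<^esub> h) = c g \<circ> c h" if "g \<in> carrier G" "h \<in> carrier G" for g h
    using that by (auto simp: c_def G.m_assoc fun_eq_iff)
  have c_one: "c \<one>\<^bsub>G\<^esub> = id" by (auto simp: c_def fun_eq_iff)
  have c_bij: "bij (c g)" if "g \<in> carrier G" for g
    by (rule o_bij[of "c (inv\<^bsub>G\<^esub> g)"]) (use that in \<open>simp_all add: c_one flip: c_mult\<close>)
  have over: "overgroup G H c"
  proof -
    have "inj_on c (carrier G)"
    proof (rule inj_onI)
      fix g h assume gh: "g \<in> carrier G" "h \<in> carrier G" and "c g = c h"
      then have "c g (\<one>\<^bsub>G\<^esub>, False) = c h (\<one>\<^bsub>G\<^esub>, False)" by simp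
      then show "g = h" using gh by (simp add: c_def)
    qed
    then show ?thesis
      using G.is_group H by (auto simp: overgroup_def mon_def hom_def H_def c_mult c_bij)
  qed
  have inv_c: "inv\<^bsub>H\<^esub> (c g) = c (inv\<^bsub>G\<^esub> g)" if "g \<in> carrier G" for g
    by (rule H.inv_equality) (use that in \<open>simp_all add: H_def c_bij c_one flip: c_mult\<close>)
  \<comment> \<open>Besides the square of the unknown \<open>t\<close>, these are the commutators of
    \<open>a\<close> and \<open>t b t\<close>, with \<open>t\<close> written for its own
    inverse.\<close>
  define F where "F = insert [(Unknown 0, False), (Unknown 0, False)]
    ((\<lambda>(a, b). [(Const a, False), (Unknown 0, False), (Const b, False), (Unknown 0, False),
       (Const a, True), (Unknown 0, False), (Const b, True), (Unknown 0, False)]) ` (A \<times> A))"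
  have "finite F" using A by (simp add: F_def)
  moreover have "F \<subseteq> group_words G 1" using A(2) by (auto simp: F_def group_words_def image_iff subset_iff)
  moreover have "is_solution H c F 1 (\<lambda>_. s)"
  proof -
    have "bij s" by (rule o_bij[of s]) (auto simp: s_def)
    \<comment> \<open>Conjugated by \<open>s\<close>, \<open>c b\<close> moves only the second copy,
      so it commutes with \<open>c a\<close>.\<close>
    moreover have "c a \<circ> (s \<circ> (c b \<circ> (s \<circ> (c (inv\<^bsub>G\<^esub> a) \<circ> (s \<circ> (c (inv\<^bsub>G\<^esub> b) \<circ> s)))))) = id"
      if "a \<in> carrier G" "b \<in> carrier G" for a b
      using that by (auto simp: fun_eq_iff c_def s_def simp flip: G.m_assoc)
    moreover have "s \<circ> s = id" by (auto simp: s_def fun_eq_iff)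
    ultimately show ?thesis
      using A(2) inv_c by (auto simp: is_solution_def F_def H_def subset_iff)
  qed
  ultimately obtain x where x: "is_solution G id F 1 x"
    using algebraically_closed_solution[OF ac _ _ over] by blast
  define t where "t = x 0"
  have t: "t \<in> carrier G" "t \<otimes>\<^bsub>G\<^esub> t = \<one>\<^bsub>G\<^esub>"
    using x by (auto simp: is_solution_def F_def t_def)
  have "a \<otimes>\<^bsub>G\<^esub> (t \<otimes>\<^bsub>G\<^esub> b \<otimes>\<^bsub>G\<^esub> t) = t \<otimes>\<^bsub>G\<^esub> b \<otimes>\<^bsub>G\<^esub> t \<otimes>\<^bsub>G\<^esub> a" if "a \<in> A" "b \<in> A" for a b
  proof -
    have ab: "a \<in> carrier G" "b \<in> carrier G" using that A by auto
    have tt: "t \<otimes>\<^bsub>G\<^esub> (t \<otimes>\<^bsub>G\<^esub> z) = z" if "z \<in> carrier G" for z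
      using t that by (simp flip: G.m_assoc)
    have bb: "b \<otimes>\<^bsub>G\<^esub> (inv\<^bsub>G\<^esub> b \<otimes>\<^bsub>G\<^esub> z) = z" "inv\<^bsub>G\<^esub> b \<otimes>\<^bsub>G\<^esub> (b \<otimes>\<^bsub>G\<^esub> z) = z" if "z \<in> carrier G" for z
      using ab that by (simp_all flip: G.m_assoc)
    have aa: "inv\<^bsub>G\<^esub> a \<otimes>\<^bsub>G\<^esub> (a \<otimes>\<^bsub>G\<^esub> z) = z" if "z \<in> carrier G" for z
      using ab that by (simp flip: G.m_assoc)
    have "a \<otimes>\<^bsub>G\<^esub> (t \<otimes>\<^bsub>G\<^esub> (b \<otimes>\<^bsub>G\<^esub> (t \<otimes>\<^bsub>G\<^esub> (inv\<^bsub>G\<^esub> a \<otimes>\<^bsub>G\<^esub> (t \<otimes>\<^bsub>G\<^esub> (inv\<^bsub>G\<^esub> b \<otimes>\<^bsub>G\<^esub> t)))))) = \<one>\<^bsub>G\<^esub>"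
      using x that t ab by (auto simp: is_solution_def F_def t_def)
    then have "a \<otimes>\<^bsub>G\<^esub> (t \<otimes>\<^bsub>G\<^esub> (b \<otimes>\<^bsub>G\<^esub> (t \<otimes>\<^bsub>G\<^esub> (inv\<^bsub>G\<^esub> a \<otimes>\<^bsub>G\<^esub> (t \<otimes>\<^bsub>G\<^esub> (inv\<^bsub>G\<^esub> b \<otimes>\<^bsub>G\<^esub> t))))))
        \<otimes>\<^bsub>G\<^esub> (t \<otimes>\<^bsub>G\<^esub> (b \<otimes>\<^bsub>G\<^esub> (t \<otimes>\<^bsub>G\<^esub> a))) = t \<otimes>\<^bsub>G\<^esub> (b \<otimes>\<^bsub>G\<^esub> (t \<otimes>\<^bsub>G\<^esub> a))"
      using t ab by simp
    then show ?thesis using t ab by (simp add: G.m_assoc tt bb aa)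
  qed
  then show ?thesis using t by blast
qed

locale commuting_involutions = group G
  for G :: "('a, 'm) monoid_scheme" (structure) +
  fixes S :: "'a set" and t :: "nat \<Rightarrow> 'a"
  assumes S_fin: "finite S" and S_ne: "S \<noteq> {}" and S_sub: "S \<subseteq> carrier G"
    and t_closed [simp]: "t k \<in> carrier G" and t_square [simp]: "t k \<otimes> t k = \<one>"
    and t_commute: "a \<in> S \<union> t ` {..<k} \<Longrightarrow> b \<in> S \<union> t ` {..<k} \<Longrightarrow>
      a \<otimes> (t k \<otimes> b \<otimes> t k) = t k \<otimes> b \<otimes> t k \<otimes> a"

lemma algebraically_closed_commuting_involutions:
  fixes G :: "('a, 'm) monoid_scheme"
  assumes ac: "algebraically_closed G" and S: "finite S" "S \<noteq> {}" "S \<subseteq> carrier G"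
  shows "\<exists>t. commuting_involutions G S t"
proof -
  define P where "P = (\<lambda>t A. t \<in> carrier G \<and> t \<otimes>\<^bsub>G\<^esub> t = \<one>\<^bsub>G\<^esub> \<and>
    (\<forall>a\<in>A. \<forall>b\<in>A. a \<otimes>\<^bsub>G\<^esub> (t \<otimes>\<^bsub>G\<^esub> b \<otimes>\<^bsub>G\<^esub> t) = t \<otimes>\<^bsub>G\<^esub> b \<otimes>\<^bsub>G\<^esub> t \<otimes>\<^bsub>G\<^esub> a))"
  have "\<exists>A. \<forall>k :: nat. (finite (A k) \<and> S \<subseteq> A k \<and> A k \<subseteq> carrier G) \<and> (\<exists>t. A (Suc k) = insert t (A k) \<and> P t (A k))"
  proof (rule dependent_nat_choice)
    show "\<exists>A. finite A \<and> S \<subseteq> A \<and> A \<subseteq> carrier G" using S by blast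
  next
    fix A and k :: nat assume A: "finite A \<and> S \<subseteq> A \<and> A \<subseteq> carrier G"
    then obtain t where "P t A"
      using algebraically_closed_commuting_involution[OF ac, of A] unfolding P_def by blast
    then show "\<exists>B. (finite B \<and> S \<subseteq> B \<and> B \<subseteq> carrier G) \<and> (\<exists>t. B = insert t A \<and> P t A)"
      using A by (intro exI[of _ "insert t A"]) (auto simp: P_def)
  qed
  then obtain A where A: "\<And>k. S \<subseteq> A k" and "\<forall>k. \<exists>t. A (Suc k) = insert t (A k) \<and> P t (A k)" by blast
  then obtain t where t: "\<And>k. A (Suc k) = insert (t k) (A k)" "\<And>k. P (t k) (A k)" by metis
  have sub: "S \<union> t ` {..<k} \<subseteq> A k" for k
    using A by (induction k) (auto simp: t(1) lessThan_Suc)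
  have "group G" using ac by (simp add: algebraically_closed_def)
  moreover have "commuting_involutions_axioms G S t"
  proof
    fix k a b assume "a \<in> S \<union> t ` {..<k}" "b \<in> S \<union> t ` {..<k}"
    then show "a \<otimes>\<^bsub>G\<^esub> (t k \<otimes>\<^bsub>G\<^esub> b \<otimes>\<^bsub>G\<^esub> t k) = t k \<otimes>\<^bsub>G\<^esub> b \<otimes>\<^bsub>G\<^esub> t k \<otimes>\<^bsub>G\<^esub> a"
      using t(2)[of k] sub[of k] by (auto simp: P_def subset_iff)
  qed (use S t(2) in \<open>auto simp: P_def\<close>)
  ultimately show ?thesis by (auto simp: commuting_involutions_def)
qed

section \<open>Random points of the wreath products\<close>

primrec sequence_pmf :: "'w pmf list \<Rightarrow> 'w list pmf" where
  "sequence_pmf [] = return_pmf []"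
| "sequence_pmf (p # ps) = bind_pmf p (\<lambda>x. map_pmf ((#) x) (sequence_pmf ps))"

lemma set_sequence_pmf: "set_pmf (sequence_pmf ps) = {xs. list_all2 (\<lambda>x p. x \<in> set_pmf p) xs ps}"
proof (induction ps)
  case (Cons p ps)
  then show ?case by (auto simp: list_all2_Cons2)
qed auto

lemma finite_sequence_pmf: "(\<And>p. p \<in> set ps \<Longrightarrow> finite (set_pmf p)) \<Longrightarrow> finite (set_pmf (sequence_pmf ps))"
  by (induction ps) auto

lemma finite_sequence_replicate [simp]:
  "finite (set_pmf p) \<Longrightarrow> finite (set_pmf (sequence_pmf (replicate m p)))"
  by (rule finite_sequence_pmf) auto

lemma length_sequence_pmf: "xs \<in> set_pmf (sequence_pmf ps) \<Longrightarrow> length xs = length ps"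
  by (simp add: set_sequence_pmf list_all2_lengthD)

text \<open>Independent parameters can be averaged coordinate by coordinate, since the value of the
  first coordinate may be drawn before the parameters of the others.\<close>

lemma sequence_bind:
  "length xs = m \<Longrightarrow> bind_pmf (sequence_pmf (replicate m p)) (\<lambda>zs. sequence_pmf (map2 F xs zs))
     = sequence_pmf (map (\<lambda>x. bind_pmf p (F x)) xs)"
proof (induction xs arbitrary: m)
  case (Cons x xs)
  define m' where "m' = length xs"
  have m: "m = Suc m'" using Cons(2) by (simp add: m'_def)
  have "bind_pmf (sequence_pmf (replicate m p)) (\<lambda>zs. sequence_pmf (map2 F (x # xs) zs))
     = bind_pmf p (\<lambda>z. bind_pmf (sequence_pmf (replicate m' p)) (\<lambda>zs.
         bind_pmf (F x z) (\<lambda>y. map_pmf ((#) y) (sequence_pmf (map2 F xs zs)))))"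
    by (simp add: m bind_assoc_pmf bind_return_pmf map_pmf_def)
  also have "\<dots> = bind_pmf p (\<lambda>z. bind_pmf (F x z) (\<lambda>y.
      bind_pmf (sequence_pmf (replicate m' p)) (\<lambda>zs. map_pmf ((#) y) (sequence_pmf (map2 F xs zs)))))"
    by (subst bind_commute_pmf) (rule refl)
  also have "\<dots> = bind_pmf p (\<lambda>z. bind_pmf (F x z) (\<lambda>y. map_pmf ((#) y)
      (bind_pmf (sequence_pmf (replicate m' p)) (\<lambda>zs. sequence_pmf (map2 F xs zs)))))"
    by (simp add: map_bind_pmf)
  finally show ?case by (simp add: Cons(1)[OF m'_def[symmetric]] bind_assoc_pmf)
qed (simp add: bind_return_pmf)

lemma sequence_map2:
  "sequence_pmf (map (\<lambda>x. map_pmf (h x) p) xs)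
     = map_pmf (map2 h xs) (sequence_pmf (replicate (length xs) p))"
proof (induction xs)
  case (Cons x xs)
  then show ?case by (simp add: map_pmf_def bind_assoc_pmf bind_return_pmf)
qed simp

lemma sequence_map: "sequence_pmf (map (map_pmf h) ps) = map_pmf (map h) (sequence_pmf ps)"
  by (induction ps) (simp_all add: map_pmf_def bind_assoc_pmf bind_return_pmf)

datatype 'a dyadic = Leaf 'a | Node "'a dyadic" "'a dyadic"

definition coin :: "bool pmf" where "coin = pmf_of_set UNIV"

text \<open>This invariance is what lets \<open>toss\<close> absorb an involution.\<close>

lemma coin_flip: "bind_pmf coin (\<lambda>e. F (\<not> e)) = bind_pmf coin F"
proof -
  have "map_pmf Not coin = coin"
    unfolding coin_def by (subst map_pmf_of_set_inj) (auto simp: inj_def UNIV_bool insert_commute)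
  then have "bind_pmf coin F = bind_pmf (map_pmf Not coin) F" by simp
  then show ?thesis by (simp add: bind_map_pmf)
qed

context commuting_involutions
begin

abbreviation K :: "nat \<Rightarrow> 'a set" where "K k \<equiv> generate G (S \<union> t ` {..<k})"

lemma gens_sub: "S \<union> t ` {..<k} \<subseteq> carrier G"
  using S_sub by auto

lemma K_sub: "K k \<subseteq> carrier G"
  by (rule generate_incl[OF gens_sub])

lemma commute_generate:
  assumes "A \<subseteq> carrier G" "u \<in> carrier G" "\<And>a. a \<in> A \<Longrightarrow> a \<otimes> u = u \<otimes> a" "x \<in> generate G A"
  shows "x \<otimes> u = u \<otimes> x"
  using assms(4)
proof induction
  case (inv h)
  then have h: "h \<in> carrier G" "h \<otimes> u = u \<otimes> h" using assms by auto
  have "inv h \<otimes> u = inv h \<otimes> (u \<otimes> h) \<otimes> inv h" using h(1) assms(2) by (simp add: m_assoc)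
  also have "\<dots> = inv h \<otimes> (h \<otimes> u) \<otimes> inv h" by (simp only: h(2))
  also have "\<dots> = u \<otimes> inv h" using h(1) assms(2) by (simp flip: m_assoc)
  finally show ?case .
next
  case (eng h1 h2)
  then have "h1 \<in> carrier G" "h2 \<in> carrier G" using generate_incl[OF assms(1)] by auto
  then show ?case using eng assms(2) by (metis m_assoc)
qed (use assms in auto)

lemma t_cancel: "z \<in> carrier G \<Longrightarrow> t k \<otimes> (t k \<otimes> z) = z"
  by (simp flip: m_assoc)

text \<open>Commutation passes from generators to the subgroup in one argument at a time;
  conjugating by \<open>t k\<close> exchanges the two arguments.\<close>

lemma t_commute_K:
  assumes "x \<in> K k" "y \<in> K k"
  shows "x \<otimes> (t k \<otimes> y \<otimes> t k) = t k \<otimes> y \<otimes> t k \<otimes> x"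
proof -
  have x: "x \<in> carrier G" and y: "y \<in> carrier G" using assms K_sub by auto
  have "b \<otimes> (t k \<otimes> x \<otimes> t k) = t k \<otimes> x \<otimes> t k \<otimes> b" if b: "b \<in> S \<union> t ` {..<k}" for b
  proof -
    have bc: "b \<in> carrier G" using b gens_sub by blast
    have "x \<otimes> (t k \<otimes> b \<otimes> t k) = t k \<otimes> b \<otimes> t k \<otimes> x"
      by (rule commute_generate[OF gens_sub _ _ assms(1)]) (use bc t_commute b in auto)
    then have "t k \<otimes> (x \<otimes> (t k \<otimes> b \<otimes> t k)) \<otimes> t k = t k \<otimes> (t k \<otimes> b \<otimes> t k \<otimes> x) \<otimes> t k" by simp
    then show ?thesis using x bc by (simp add: m_assoc t_cancel)
  qed
  then have "y \<otimes> (t k \<otimes> x \<otimes> t k) = t k \<otimes> x \<otimes> t k \<otimes> y"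
    by (intro commute_generate[OF gens_sub _ _ assms(2)]) (use x in auto)
  then have "t k \<otimes> (y \<otimes> (t k \<otimes> x \<otimes> t k)) \<otimes> t k = t k \<otimes> (t k \<otimes> x \<otimes> t k \<otimes> y) \<otimes> t k" by simp
  then show ?thesis using x y by (simp add: m_assoc t_cancel)
qed

definition toss :: "nat \<Rightarrow> bool \<Rightarrow> 'a" where "toss k e = (if e then t k else \<one>)"

lemma toss_closed [simp]: "toss k e \<in> carrier G"
  by (simp add: toss_def)

lemma t_toss: "t k \<otimes> toss k e = toss k (\<not> e)"
  by (simp add: toss_def)

text \<open>
  A complete tree of depth \<open>k\<close> encodes a point of \<open>S ^ (2 ^ k)\<close>. The involutions
  \<open>t 0, \<dots>, t (k - 1)\<close> move \<open>S\<close> to \<open>2 ^ k\<close> commuting conjugates, and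
  \<open>place x k\<close> is the law of the product of the correspondingly conjugated leaves of \<open>x\<close>,
  followed by a random element of the finite group generated by these involutions.
\<close>

primrec place :: "'a dyadic \<Rightarrow> nat \<Rightarrow> 'a pmf" where
  "place (Leaf s) = (\<lambda>k. return_pmf s)"
| "place (Node x z) = (\<lambda>k. bind_pmf (place x (k - 1)) (\<lambda>p. bind_pmf (place z (k - 1)) (\<lambda>q.
     map_pmf (\<lambda>e. p \<otimes> (t (k - 1) \<otimes> q \<otimes> t (k - 1)) \<otimes> toss (k - 1) e) coin)))"

primrec leaves :: "nat \<Rightarrow> 'a dyadic pmf" where
  "leaves 0 = map_pmf Leaf (pmf_of_set S)"
| "leaves (Suc k) = bind_pmf (leaves k) (\<lambda>x. map_pmf (Node x) (leaves k))"

lemma finite_leaves [simp]: "finite (set_pmf (leaves k))"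
  by (induction k) (use S_fin S_ne in auto)

lemma finite_place [simp]: "finite (set_pmf (place x k))"
  by (induction x arbitrary: k) auto

text \<open>Membership in \<open>K k\<close> is what \<open>t_commute_K\<close> requires of the two
  halves at level \<open>k\<close>.\<close>

lemma place_K:
  "x \<in> set_pmf (leaves k) \<Longrightarrow> set_pmf (place x k) \<subseteq> K k"
proof (induction k arbitrary: x)
  case 0
  then show ?case using S_fin S_ne by (auto intro: generate.incl)
next
  case (Suc k)
  then obtain y z where x: "x = Node y z" and yz: "y \<in> set_pmf (leaves k)" "z \<in> set_pmf (leaves k)" by auto
  have mono: "K k \<subseteq> K (Suc k)" by (rule mono_generate) auto
  have tK: "t k \<in> K (Suc k)" by (auto intro: generate.incl)
  have "toss k e \<in> K (Suc k)" for e using tK by (simp add: toss_def generate.one)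
  then show ?case
    using Suc.IH[OF yz(1)] Suc.IH[OF yz(2)] mono tK by (auto simp: x intro!: generate.eng)
qed

lemma place_carrier: "x \<in> set_pmf (leaves k) \<Longrightarrow> g \<in> set_pmf (place x k) \<Longrightarrow> g \<in> carrier G"
  using place_K K_sub by blast

text \<open>The factor contributed by levels \<open>j\<close> to \<open>j + d - 1\<close>: a fresh
  conjugated second half and a toss for each. The recursion goes up in \<open>j\<close>, so that the
  factor can stand to the right of \<open>place x j\<close>; \<open>tail k 0\<close> leaves out
  exactly the first leaf.\<close>

primrec tail :: "nat \<Rightarrow> nat \<Rightarrow> 'a pmf" where
  "tail 0 = (\<lambda>j. return_pmf \<one>)"
| "tail (Suc d) = (\<lambda>j. bind_pmf (leaves j) (\<lambda>z. bind_pmf (place z j) (\<lambda>q. bind_pmf coin (\<lambda>e.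
     map_pmf (\<lambda>r. t j \<otimes> q \<otimes> t j \<otimes> toss j e \<otimes> r) (tail d (Suc j))))))"

lemma finite_tail [simp]: "finite (set_pmf (tail d j))"
  by (induction d arbitrary: j) auto

lemma tail_carrier: "g \<in> set_pmf (tail d j) \<Longrightarrow> g \<in> carrier G"
  by (induction d arbitrary: j g) (auto intro!: m_closed dest: place_carrier)

text \<open>The conditional law, given the first \<open>2 ^ j\<close> leaves, of a random tree of depth \<open>j + d\<close>.\<close>

definition law :: "nat \<Rightarrow> nat \<Rightarrow> 'a dyadic \<Rightarrow> 'a pmf" where
  "law j d x = bind_pmf (place x j) (\<lambda>p. map_pmf (\<lambda>r. p \<otimes> r) (tail d j))"

lemma finite_law [simp]: "finite (set_pmf (law j d x))"
  by (simp add: law_def)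

lemma law_carrier: "x \<in> set_pmf (leaves j) \<Longrightarrow> g \<in> set_pmf (law j d x) \<Longrightarrow> g \<in> carrier G"
  by (auto simp: law_def dest: place_carrier tail_carrier)

text \<open>A random second half, with its toss, is the first factor of the longer tail.\<close>

lemma law_average_right:
  assumes "x \<in> set_pmf (leaves j)"
  shows "bind_pmf (leaves j) (\<lambda>z. law (Suc j) d (Node x z)) = law j (Suc d) x"
proof -
  have "bind_pmf (leaves j) (\<lambda>z. law (Suc j) d (Node x z)) =
      bind_pmf (leaves j) (\<lambda>z. bind_pmf (place x j) (\<lambda>p. bind_pmf (place z j) (\<lambda>q. bind_pmf coin (\<lambda>e.
        map_pmf (\<lambda>r. p \<otimes> (t j \<otimes> q \<otimes> t j) \<otimes> toss j e \<otimes> r) (tail d (Suc j))))))"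
    by (simp add: law_def map_pmf_def bind_assoc_pmf bind_return_pmf)
  also have "\<dots> = bind_pmf (place x j) (\<lambda>p. bind_pmf (leaves j) (\<lambda>z. bind_pmf (place z j) (\<lambda>q. bind_pmf coin (\<lambda>e.
        map_pmf (\<lambda>r. p \<otimes> (t j \<otimes> q \<otimes> t j) \<otimes> toss j e \<otimes> r) (tail d (Suc j))))))"
    by (rule bind_commute_pmf)
  also have "\<dots> = bind_pmf (place x j) (\<lambda>p. bind_pmf (leaves j) (\<lambda>z. bind_pmf (place z j) (\<lambda>q. bind_pmf coin (\<lambda>e.
        map_pmf (\<lambda>r. p \<otimes> (t j \<otimes> q \<otimes> t j \<otimes> toss j e \<otimes> r)) (tail d (Suc j))))))"
    by (intro bind_pmf_cong map_pmf_cong refl)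
       (use assms in \<open>auto simp: m_assoc dest!: place_carrier tail_carrier\<close>)
  also have "\<dots> = law j (Suc d) x"
    by (simp add: law_def map_pmf_def bind_assoc_pmf bind_return_pmf)
  finally show ?thesis .
qed

text \<open>The values \<open>q\<close> and \<open>t j p t j\<close> of the two halves commute, so
  \<open>t j\<close> times their product is \<open>p (t j q t j) t j\<close>; the last factor
  disappears into the toss.\<close>

lemma law_swap:
  assumes "x \<in> set_pmf (leaves j)" "z \<in> set_pmf (leaves j)"
  shows "law (Suc j) d (Node x z) = map_pmf ((\<otimes>) (t j)) (law (Suc j) d (Node z x))"
proof -
  have "map_pmf ((\<otimes>) (t j)) (law (Suc j) d (Node z x)) =
      bind_pmf (place z j) (\<lambda>q. bind_pmf (place x j) (\<lambda>p. bind_pmf coin (\<lambda>e.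
        map_pmf (\<lambda>r. t j \<otimes> (q \<otimes> (t j \<otimes> p \<otimes> t j) \<otimes> toss j e \<otimes> r)) (tail d (Suc j)))))"
    by (simp add: law_def map_pmf_def bind_assoc_pmf bind_return_pmf)
  also have "\<dots> = bind_pmf (place z j) (\<lambda>q. bind_pmf (place x j) (\<lambda>p. bind_pmf coin (\<lambda>e.
        map_pmf (\<lambda>r. p \<otimes> (t j \<otimes> q \<otimes> t j) \<otimes> toss j (\<not> e) \<otimes> r) (tail d (Suc j)))))"
  proof (intro bind_pmf_cong map_pmf_cong refl)
    fix p q r e assume pq: "q \<in> set_pmf (place z j)" "p \<in> set_pmf (place x j)" and r: "r \<in> set_pmf (tail d (Suc j))"
    then have c: "p \<in> carrier G" "q \<in> carrier G" "r \<in> carrier G"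
      using assms place_carrier tail_carrier by blast+
    have K: "p \<in> K j" "q \<in> K j" using pq assms place_K by blast+
    have "t j \<otimes> (q \<otimes> (t j \<otimes> p \<otimes> t j)) = t j \<otimes> (t j \<otimes> p \<otimes> t j \<otimes> q)"
      by (simp only: t_commute_K[OF K(2,1)])
    also have "\<dots> = p \<otimes> (t j \<otimes> q \<otimes> t j) \<otimes> t j"
      using c by (simp add: m_assoc t_cancel)
    finally have "t j \<otimes> (q \<otimes> (t j \<otimes> p \<otimes> t j)) = p \<otimes> (t j \<otimes> q \<otimes> t j) \<otimes> t j" .
    then have "t j \<otimes> (q \<otimes> (t j \<otimes> p \<otimes> t j)) \<otimes> (toss j e \<otimes> r) = p \<otimes> (t j \<otimes> q \<otimes> t j) \<otimes> t j \<otimes> (toss j e \<otimes> r)" by simp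
    also have "\<dots> = p \<otimes> (t j \<otimes> q \<otimes> t j) \<otimes> toss j (\<not> e) \<otimes> r"
      using c by (simp add: m_assoc t_cancel t_toss[of j e, symmetric])
    finally show "t j \<otimes> (q \<otimes> (t j \<otimes> p \<otimes> t j) \<otimes> toss j e \<otimes> r) = p \<otimes> (t j \<otimes> q \<otimes> t j) \<otimes> toss j (\<not> e) \<otimes> r"
      using c by (simp add: m_assoc)
  qed
  also have "\<dots> = bind_pmf (place z j) (\<lambda>q. bind_pmf (place x j) (\<lambda>p. bind_pmf coin (\<lambda>e.
        map_pmf (\<lambda>r. p \<otimes> (t j \<otimes> q \<otimes> t j) \<otimes> toss j e \<otimes> r) (tail d (Suc j)))))"
    by (subst coin_flip[symmetric]) simp
  also have "\<dots> = bind_pmf (place x j) (\<lambda>p. bind_pmf (place z j) (\<lambda>q. bind_pmf coin (\<lambda>e.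
        map_pmf (\<lambda>r. p \<otimes> (t j \<otimes> q \<otimes> t j) \<otimes> toss j e \<otimes> r) (tail d (Suc j)))))"
    by (rule bind_commute_pmf)
  also have "\<dots> = law (Suc j) d (Node x z)"
    by (simp add: law_def map_pmf_def bind_assoc_pmf bind_return_pmf)
  finally show ?thesis by (rule sym)
qed

lemma law_average_left:
  assumes "z \<in> set_pmf (leaves j)"
  shows "bind_pmf (leaves j) (\<lambda>x. law (Suc j) d (Node x z)) = map_pmf ((\<otimes>) (t j)) (law j (Suc d) z)"
proof -
  have "bind_pmf (leaves j) (\<lambda>x. law (Suc j) d (Node x z))
      = bind_pmf (leaves j) (\<lambda>x. map_pmf ((\<otimes>) (t j)) (law (Suc j) d (Node z x)))"
    by (intro bind_pmf_cong refl) (rule law_swap[OF _ assms])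
  then show ?thesis
    by (simp add: law_average_right[OF assms] flip: map_bind_pmf)
qed

end

section \<open>The prism operator\<close>

text \<open>The alternating sum over the faces of a simplex, in a recursive form suited to induction
  on the vertex list.\<close>

primrec alt_sum :: "'a list \<Rightarrow> ('a list \<Rightarrow> 'e::real_vector) \<Rightarrow> 'e" where
  "alt_sum [] = (\<lambda>f. 0)"
| "alt_sum (x # xs) = (\<lambda>f. f xs - alt_sum xs (\<lambda>w. f (x # w)))"

text \<open>The standard triangulation of a prism, with sign \<open>(-1) ^ i\<close> for the simplex
  that follows the first components up to vertex \<open>i\<close> and the second ones from vertex
  \<open>i\<close> on.\<close>

primrec prism :: "('a \<times> 'a) list \<Rightarrow> ('a list \<Rightarrow> 'e::real_vector) \<Rightarrow> 'e" where
  "prism [] = (\<lambda>f. 0)"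
| "prism (p # ps) = (\<lambda>f. f (fst p # snd p # map snd ps) - prism ps (\<lambda>w. f (fst p # w)))"

lemma alt_sum_omit: "alt_sum xs f = (\<Sum>i<length xs. (-1) ^ i *\<^sub>R f (omit i xs))"
proof (induction xs arbitrary: f)
  case (Cons x xs)
  have "alt_sum (x # xs) f = f xs + (\<Sum>i<length xs. (-1) ^ Suc i *\<^sub>R f (omit (Suc i) (x # xs)))"
    by (simp add: Cons omit_def sum_negf)
  then show ?case by (simp add: sum.lessThan_Suc_shift omit_def del: sum.lessThan_Suc)
qed simp

lemma coboundary_alt_sum: "xs \<in> tuples G (Suc k) \<Longrightarrow> coboundary G k f xs = alt_sum xs f"
  by (simp add: coboundary_def alt_sum_omit tuples_def flip: lessThan_Suc_atMost)

lemma alt_sum_cong: "(\<And>i. i < length xs \<Longrightarrow> f (omit i xs) = g (omit i xs)) \<Longrightarrow> alt_sum xs f = alt_sum xs g"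
  by (simp add: alt_sum_omit)

lemma alt_sum_diff: "alt_sum xs (\<lambda>w. f w - g w) = alt_sum xs f - alt_sum xs g"
  by (simp add: alt_sum_omit scaleR_diff_right sum_subtractf)

lemma alt_sum_linear: "linear L \<Longrightarrow> L (alt_sum xs f) = alt_sum xs (\<lambda>w. L (f w))"
  by (simp add: alt_sum_omit linear_sum linear_scale)

lemma alt_sum_const: "alt_sum xs (\<lambda>_. c) = (if odd (length xs) then c else 0)"
  by (induction xs) auto

lemma alt_sum_map: "alt_sum (map h xs) f = alt_sum xs (\<lambda>w. f (map h w))"
  by (induction xs arbitrary: f) simp_all

lemma alt_sum_mean: "alt_sum xs (\<lambda>w. mean p (\<lambda>r. c r w)) = mean p (\<lambda>r. alt_sum xs (c r))"
  by (induction xs arbitrary: c) (simp_all add: mean_diff mean_def[of _ "\<lambda>_. 0"])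

lemma alt_sum_tendsto:
  fixes g :: "'i \<Rightarrow> 'a list \<Rightarrow> real"
  assumes "\<And>w. ((\<lambda>k. g k w) \<longlongrightarrow> l w) U"
  shows "((\<lambda>k. alt_sum xs (g k)) \<longlongrightarrow> alt_sum xs l) U"
  unfolding alt_sum_omit by (intro tendsto_sum tendsto_scaleR tendsto_const assms)

text \<open>Omitting one entry of a list of independent random variables with the same law
  leaves a list of the same kind.\<close>

lemma alt_sum_mean_sequence:
  assumes p: "finite (set_pmf p)"
  shows "alt_sum xs (\<lambda>w. mean (sequence_pmf (replicate (length w) p)) (\<lambda>rs. g (map2 h w rs)))
    = mean (sequence_pmf (replicate (length xs) p)) (\<lambda>rs. alt_sum (map2 h xs rs) g)"
proof (induction xs arbitrary: g)
  case (Cons x xs)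
  have fin: "finite (set_pmf (sequence_pmf (replicate m p)))" for m
    using p by (intro finite_sequence_pmf) auto
  have step: "mean (sequence_pmf (replicate (length (x # w)) p)) (\<lambda>rs. g' (map2 h (x # w) rs))
      = mean p (\<lambda>r. mean (sequence_pmf (replicate (length w) p)) (\<lambda>rs. g' (h x r # map2 h w rs)))" for w g'
    using p fin by (simp add: mean_bind mean_map)
  show ?case
    unfolding alt_sum.simps(2) step alt_sum_mean Cons[of g] Cons[of "\<lambda>w. g (h x _ # w)"]
    using p fin by (simp add: mean_bind mean_map mean_diff)
qed simp

lemma prism_cong:
  assumes "\<And>w. length w = Suc (length ps) \<Longrightarrow> set w \<subseteq> fst ` set ps \<union> snd ` set ps \<Longrightarrow> f w = g w"
  shows "prism ps f = prism ps g"
  using assms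
proof (induction ps arbitrary: f g)
  case (Cons p ps)
  have "prism ps (\<lambda>w. f (fst p # w)) = prism ps (\<lambda>w. g (fst p # w))"
    by (rule Cons.IH, rule Cons.prems) auto
  moreover have "f (fst p # snd p # map snd ps) = g (fst p # snd p # map snd ps)"
    by (rule Cons.prems) auto
  ultimately show ?case by simp
qed simp

lemma prism_diff: "prism ps (\<lambda>w. f w - g w) = prism ps f - prism ps g"
  by (induction ps arbitrary: f g) simp_all

lemma prism_zero: "prism ps (\<lambda>_. 0) = 0"
  by (induction ps) simp_all

lemma prism_linear: "linear L \<Longrightarrow> L (prism ps f) = prism ps (\<lambda>w. L (f w))"
  by (induction ps arbitrary: f) (simp_all add: linear_diff linear_0)

lemma prism_map: "prism (map (map_prod h h) ps) f = prism ps (\<lambda>w. f (map h w))"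
  by (induction ps arbitrary: f) (simp_all add: comp_def)

lemma norm_prism_le:
  fixes f :: "'a list \<Rightarrow> 'e::real_normed_vector"
  assumes "\<And>w. norm (f w) \<le> C"
  shows "norm (prism ps f) \<le> real (length ps) * C"
  using assms
proof (induction ps arbitrary: f)
  case (Cons p ps)
  have "norm (prism (p # ps) f) \<le> norm (f (fst p # snd p # map snd ps)) + norm (prism ps (\<lambda>w. f (fst p # w)))"
    by (simp add: norm_triangle_ineq4)
  also have "\<dots> \<le> C + real (length ps) * C"
    using Cons by (intro add_mono) auto
  finally show ?case by (simp add: algebra_simps)
qed simp

text \<open>In the first term, faces are taken of the list of pairs. When \<open>f\<close> is a
  cocycle the second term vanishes, and \<open>prism\<close> gives a primitive of the
  difference.\<close>

lemma prism_homotopy: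
  "alt_sum ps (\<lambda>qs. prism qs f) + prism ps (\<lambda>w. alt_sum w f) = f (map snd ps) - f (map fst ps)"
proof (induction ps arbitrary: f)
  case (Cons p ps)
  have "alt_sum (map snd ps) (\<lambda>w. f (fst p # snd p # w)) = alt_sum ps (\<lambda>qs. f (fst p # snd p # map snd qs))"
    by (rule alt_sum_map)
  then show ?case
    using Cons[of "\<lambda>w. f (fst p # w)"] by (simp add: alt_sum_diff prism_diff algebra_simps)
qed simp

section \<open>Averaged cocycles\<close>

locale isometric_dual_module = banach_module G act + isometric_duality T
  for G :: "('a, 'm) monoid_scheme" (structure) and act :: "'a \<Rightarrow> 'e::banach \<Rightarrow> 'e"
    and T :: "'e \<Rightarrow> ('f::banach \<Rightarrow>\<^sub>L real)" +
  fixes act' :: "'a \<Rightarrow> 'f \<Rightarrow> 'f"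
  assumes act': "banach_module G act'"
    and T_act: "g \<in> carrier G \<Longrightarrow> T (act g v) = contragredient G act' g (T v)"
begin

lemma pairing_act:
  "g \<in> carrier G \<Longrightarrow> blinfun_apply (T (act g v)) \<phi> = blinfun_apply (T v) (act' (inv g) \<phi>)"
  by (simp add: T_act banach_module.contragredient_apply[OF act'])

text \<open>A contragredient action is weak-* continuous: it moves to the other side of the
  pairing.\<close>

lemma act_weak_star_limit:
  assumes "g \<in> carrier G" "\<And>\<phi>. ((\<lambda>i. blinfun_apply (T (b i)) \<phi>) \<longlongrightarrow> blinfun_apply (T v) \<phi>) U"
  shows "((\<lambda>i. blinfun_apply (T (act g (b i))) \<phi>) \<longlongrightarrow> blinfun_apply (T (act g v)) \<phi>) U"
  using assms by (simp add: pairing_act)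

lemma weak_star_limit_unique:
  assumes U: "U \<noteq> bot" and a: "\<And>\<phi>. ((\<lambda>i. blinfun_apply (T (a i)) \<phi>) \<longlongrightarrow> blinfun_apply (T u) \<phi>) U"
    and b: "\<And>\<phi>. ((\<lambda>i. blinfun_apply (T (b i)) \<phi>) \<longlongrightarrow> blinfun_apply (T v) \<phi>) U"
    and eq: "eventually (\<lambda>i. a i = b i) U"
  shows "u = v"
proof (rule weak_star_eqI)
  fix \<phi>
  have "((\<lambda>i. blinfun_apply (T (a i)) \<phi>) \<longlongrightarrow> blinfun_apply (T v) \<phi>) U"
    using b by (rule tendsto_cong[THEN iffD2, rotated]) (use eq in \<open>auto elim: eventually_mono\<close>)
  with a show "blinfun_apply (T u) \<phi> = blinfun_apply (T v) \<phi>" by (rule tendsto_unique[OF U])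
qed

lemma weak_star_limit_alt_sum:
  assumes "\<And>w \<phi>. ((\<lambda>i. blinfun_apply (T (b i w)) \<phi>) \<longlongrightarrow> blinfun_apply (T (v w)) \<phi>) U"
  shows "((\<lambda>i. blinfun_apply (T (alt_sum xs (b i))) \<phi>) \<longlongrightarrow> blinfun_apply (T (alt_sum xs v)) \<phi>) U"
  unfolding alt_sum_linear[OF linear_pairing] by (intro alt_sum_tendsto assms)

lemma weak_star_limit_mean:
  assumes "\<And>w \<phi>. ((\<lambda>i. blinfun_apply (T (b i w)) \<phi>) \<longlongrightarrow> blinfun_apply (T (v w)) \<phi>) U"
  shows "((\<lambda>i. blinfun_apply (T (mean p (b i))) \<phi>) \<longlongrightarrow> blinfun_apply (T (mean p v)) \<phi>) U"
  unfolding pairing_mean by (intro mean_tendsto assms)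

end

locale randomized_cocycle = isometric_dual_module G act T act' + commuting_involutions G S t
  for G :: "('a, 'm) monoid_scheme" (structure) and act :: "'a \<Rightarrow> 'e::banach \<Rightarrow> 'e"
    and T :: "'e \<Rightarrow> ('f::banach \<Rightarrow>\<^sub>L real)" and act' :: "'a \<Rightarrow> 'f \<Rightarrow> 'f"
    and S :: "'a set" and t :: "nat \<Rightarrow> 'a" +
  fixes n :: nat and f :: "'a list \<Rightarrow> 'e" and C :: real and U :: "nat filter"
  assumes one_S: "\<one> \<in> S"
    and norm_f: "norm (f xs) \<le> C"
    and f_equivariant: "g \<in> carrier G \<Longrightarrow> xs \<in> tuples G n \<Longrightarrow> f (map ((\<otimes>) g) xs) = act g (f xs)"
    and f_cocycle: "xs \<in> tuples G (Suc n) \<Longrightarrow> alt_sum xs f = 0"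
    and U: "U \<le> sequentially" "U \<noteq> bot" "\<And>P. eventually P U \<or> eventually (\<lambda>x. \<not> P x) U"
begin

abbreviation weak_star_to :: "(nat \<Rightarrow> 'e) \<Rightarrow> 'e \<Rightarrow> bool" where
  "weak_star_to b v \<equiv> \<forall>\<phi>. ((\<lambda>k. blinfun_apply (T (b k)) \<phi>) \<longlongrightarrow> blinfun_apply (T v) \<phi>) U"

definition M_approx :: "nat \<Rightarrow> nat \<Rightarrow> 'a dyadic list \<Rightarrow> 'e" where
  "M_approx j d X = mean (sequence_pmf (map (law j d) X)) f"

text \<open>The total depth \<open>k\<close> is common to all levels \<open>j\<close>, so
  consecutive levels refer to the same random tree and the martingale identities hold before the
  limit. Truncation of \<open>k - j\<close> concerns only finitely many \<open>k\<close>, which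
  \<open>U\<close> ignores.\<close>

definition M :: "nat \<Rightarrow> 'a dyadic list \<Rightarrow> 'e" where
  "M j X = (SOME v. norm v \<le> C \<and> weak_star_to (\<lambda>k. M_approx j (k - j) X) v)"

definition forest :: "nat \<Rightarrow> 'a dyadic list pmf" where
  "forest j = sequence_pmf (replicate (Suc n) (leaves j))"

lemma finite_sequence_law [simp]: "finite (set_pmf (sequence_pmf (map (law j d) X)))"
  by (rule finite_sequence_pmf) auto

lemma finite_forest [simp]: "finite (set_pmf (forest j))"
  unfolding forest_def by (rule finite_sequence_pmf) auto

lemma M: "norm (M j X) \<le> C" "weak_star_to (\<lambda>k. M_approx j (k - j) X) (M j X)"
proof -
  have "norm (M_approx j (k - j) X) \<le> C" for k
    unfolding M_approx_def by (rule norm_mean_le) (auto simp: norm_f)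
  then have "\<exists>v. norm v \<le> C \<and> weak_star_to (\<lambda>k. M_approx j (k - j) X) v"
    using weak_star_limit[where b = "\<lambda>k. M_approx j (k - j) X", OF U(2,3)] by blast
  then have "norm (M j X) \<le> C \<and> weak_star_to (\<lambda>k. M_approx j (k - j) X) (M j X)"
    unfolding M_def by (rule someI_ex)
  then show "norm (M j X) \<le> C" "weak_star_to (\<lambda>k. M_approx j (k - j) X) (M j X)" by blast+
qed

lemma forest_D: "X \<in> set_pmf (forest j) \<Longrightarrow> length X = Suc n \<and> set X \<subseteq> set_pmf (leaves j)"
  by (auto simp: forest_def set_sequence_pmf list_all2_conv_all_nth in_set_conv_nth)

lemma sequence_law_tuples:
  assumes "X \<in> set_pmf (forest j)" "xs \<in> set_pmf (sequence_pmf (map (law j d) X))"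
  shows "xs \<in> tuples G n"
proof -
  have "length xs = Suc n" using length_sequence_pmf[OF assms(2)] forest_D[OF assms(1)] by simp
  moreover have "x \<in> carrier G" if x: "x \<in> set xs" for x
  proof -
    obtain i where i: "i < length xs" "x = xs ! i" using x by (auto simp: in_set_conv_nth)
    then have "x \<in> set_pmf (law j d (X ! i))" "i < length X"
      using assms(2) by (auto simp: set_sequence_pmf list_all2_conv_all_nth)
    moreover from this have "X ! i \<in> set_pmf (leaves j)" using forest_D[OF assms(1)] nth_mem by blast
    ultimately show ?thesis using law_carrier by blast
  qed
  ultimately show ?thesis by (auto simp: tuples_def)
qed

lemma M_approx_average_right:
  assumes "X \<in> set_pmf (forest j)"
  shows "mean (forest j) (\<lambda>Z. M_approx (Suc j) d (map2 Node X Z)) = M_approx j (Suc d) X"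
proof -
  have X: "length X = Suc n" "set X \<subseteq> set_pmf (leaves j)" using forest_D[OF assms] by auto
  have "mean (forest j) (\<lambda>Z. M_approx (Suc j) d (map2 Node X Z))
      = mean (bind_pmf (forest j) (\<lambda>Z. sequence_pmf (map2 (\<lambda>x z. law (Suc j) d (Node x z)) X Z))) f"
    by (subst mean_bind) (auto simp: M_approx_def comp_def case_prod_unfold intro!: finite_sequence_pmf)
  also have "bind_pmf (forest j) (\<lambda>Z. sequence_pmf (map2 (\<lambda>x z. law (Suc j) d (Node x z)) X Z))
      = sequence_pmf (map (\<lambda>x. bind_pmf (leaves j) (\<lambda>z. law (Suc j) d (Node x z))) X)"
    unfolding forest_def by (rule sequence_bind[OF X(1)])
  also have "map (\<lambda>x. bind_pmf (leaves j) (\<lambda>z. law (Suc j) d (Node x z))) X = map (law j (Suc d)) X"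
    using X(2) by (auto simp: law_average_right)
  finally show ?thesis by (simp add: M_approx_def)
qed

text \<open>Every coordinate receives the same left factor \<open>t j\<close>, which the
  equivariance of \<open>f\<close> turns into one isometry.\<close>

lemma M_approx_average_left:
  assumes "Z \<in> set_pmf (forest j)"
  shows "mean (forest j) (\<lambda>X. M_approx (Suc j) d (map2 Node X Z)) = act (t j) (M_approx j (Suc d) Z)"
proof -
  have Z: "length Z = Suc n" "set Z \<subseteq> set_pmf (leaves j)" using forest_D[OF assms] by auto
  have swap: "map (law (Suc j) d) (map2 Node X Z) = map2 (\<lambda>z x. law (Suc j) d (Node x z)) Z X" for X
    by (auto simp: zip_commute[of X Z])
  have "mean (forest j) (\<lambda>X. M_approx (Suc j) d (map2 Node X Z))
      = mean (bind_pmf (forest j) (\<lambda>X. sequence_pmf (map2 (\<lambda>z x. law (Suc j) d (Node x z)) Z X))) f"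
    unfolding M_approx_def swap by (subst mean_bind) (auto intro!: finite_sequence_pmf)
  also have "bind_pmf (forest j) (\<lambda>X. sequence_pmf (map2 (\<lambda>z x. law (Suc j) d (Node x z)) Z X))
      = sequence_pmf (map (\<lambda>z. bind_pmf (leaves j) (\<lambda>x. law (Suc j) d (Node x z))) Z)"
    unfolding forest_def by (rule sequence_bind[OF Z(1)])
  also have "map (\<lambda>z. bind_pmf (leaves j) (\<lambda>x. law (Suc j) d (Node x z))) Z
      = map (map_pmf ((\<otimes>) (t j))) (map (law j (Suc d)) Z)"
    using Z(2) by (auto simp: law_average_left)
  also have "mean (sequence_pmf \<dots>) f = mean (sequence_pmf (map (law j (Suc d)) Z)) (\<lambda>xs. f (map ((\<otimes>) (t j)) xs))"
    by (simp only: sequence_map mean_map[OF finite_sequence_law])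
  also have "\<dots> = mean (sequence_pmf (map (law j (Suc d)) Z)) (\<lambda>xs. act (t j) (f xs))"
    by (rule mean_cong) (simp add: f_equivariant sequence_law_tuples[OF assms])
  finally show ?thesis by (simp add: M_approx_def mean_linear[OF act_linear])
qed

lemma eventually_Suc: "eventually (\<lambda>k. k - j = Suc (k - Suc j)) U"
  by (rule filter_leD[OF U(1)]) (rule eventually_mono[OF eventually_gt_at_top[of j]], simp add: Suc_diff_Suc)

lemma M_average_right:
  assumes "X \<in> set_pmf (forest j)"
  shows "mean (forest j) (\<lambda>Z. M (Suc j) (map2 Node X Z)) = M j X"
proof (rule weak_star_limit_unique[OF U(2)])
  show "((\<lambda>k. blinfun_apply (T (mean (forest j) (\<lambda>Z. M_approx (Suc j) (k - Suc j) (map2 Node X Z)))) \<phi>)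
      \<longlongrightarrow> blinfun_apply (T (mean (forest j) (\<lambda>Z. M (Suc j) (map2 Node X Z)))) \<phi>) U" for \<phi>
    using M(2) by (intro weak_star_limit_mean) blast
  show "((\<lambda>k. blinfun_apply (T (M_approx j (k - j) X)) \<phi>) \<longlongrightarrow> blinfun_apply (T (M j X)) \<phi>) U" for \<phi>
    using M(2) by blast
  show "eventually (\<lambda>k. mean (forest j) (\<lambda>Z. M_approx (Suc j) (k - Suc j) (map2 Node X Z)) = M_approx j (k - j) X) U"
    using eventually_Suc[of j] by (rule eventually_mono) (simp add: M_approx_average_right[OF assms])
qed

lemma M_average_left:
  assumes "Z \<in> set_pmf (forest j)"
  shows "mean (forest j) (\<lambda>X. M (Suc j) (map2 Node X Z)) = act (t j) (M j Z)"
proof (rule weak_star_limit_unique[OF U(2)])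
  show "((\<lambda>k. blinfun_apply (T (mean (forest j) (\<lambda>X. M_approx (Suc j) (k - Suc j) (map2 Node X Z)))) \<phi>)
      \<longlongrightarrow> blinfun_apply (T (mean (forest j) (\<lambda>X. M (Suc j) (map2 Node X Z)))) \<phi>) U" for \<phi>
    using M(2) by (intro weak_star_limit_mean) blast
  show "((\<lambda>k. blinfun_apply (T (act (t j) (M_approx j (k - j) Z))) \<phi>) \<longlongrightarrow> blinfun_apply (T (act (t j) (M j Z))) \<phi>) U" for \<phi>
    using M(2) by (intro act_weak_star_limit) auto
  show "eventually (\<lambda>k. mean (forest j) (\<lambda>X. M_approx (Suc j) (k - Suc j) (map2 Node X Z)) = act (t j) (M_approx j (k - j) Z)) U"
    using eventually_Suc[of j] by (rule eventually_mono) (simp add: M_approx_average_left[OF assms])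
qed

lemma martingale: "self_similar_martingale T forest (map2 Node) M C"
proof
  fix k
  show "finite (set_pmf (forest 0))" by simp
  \<comment> \<open>The list of units carries no information; it brings the law into the shape of
    \<open>sequence_bind\<close>.\<close>
  have "forest (Suc k) = sequence_pmf (map (\<lambda>_. bind_pmf (leaves k) (\<lambda>x. map_pmf (Node x) (leaves k))) (replicate (Suc n) ()))"
    by (simp add: forest_def map_replicate_const)
  also have "\<dots> = bind_pmf (forest k) (\<lambda>X. sequence_pmf (map2 (\<lambda>_ x. map_pmf (Node x) (leaves k)) (replicate (Suc n) ()) X))"
    unfolding forest_def by (rule sequence_bind[symmetric]) simp
  also have "\<dots> = bind_pmf (forest k) (\<lambda>X. map_pmf (map2 Node X) (forest k))"
  proof (rule bind_pmf_cong[OF refl])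
    fix X assume "X \<in> set_pmf (forest k)"
    then have X: "length X = Suc n" using forest_D by blast
    then have "map2 (\<lambda>_ x. map_pmf (Node x) (leaves k)) (replicate (Suc n) ()) X = map (\<lambda>x. map_pmf (Node x) (leaves k)) X"
      by (intro nth_equalityI) auto
    then show "sequence_pmf (map2 (\<lambda>_ x. map_pmf (Node x) (leaves k)) (replicate (Suc n) ()) X) = map_pmf (map2 Node X) (forest k)"
      unfolding forest_def using sequence_map2[of Node "leaves k" X] X by simp
  qed
  finally show "forest (Suc k) = bind_pmf (forest k) (\<lambda>X. map_pmf (map2 Node X) (forest k))" .
next
  fix k X Z W assume Z: "Z \<in> set_pmf (forest k)" and W: "W \<in> set_pmf (forest k)"
  show "norm (mean (forest k) (\<lambda>X. M (Suc k) (map2 Node X Z)) - mean (forest k) (\<lambda>X. M (Suc k) (map2 Node X W)))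
      = norm (M k Z - M k W)"
    by (simp add: M_average_left Z W act_norm flip: linear_diff[OF act_linear])
qed (rule M M_average_right, assumption?)+

section \<open>The averaged cocycle and its homotopy to the original one\<close>

definition shifts :: "nat \<Rightarrow> nat \<Rightarrow> 'a list pmf" where
  "shifts k m = sequence_pmf (replicate m (tail k 0))"

definition blur :: "nat \<Rightarrow> 'a list \<Rightarrow> 'e" where
  "blur k w = mean (shifts k (length w)) (\<lambda>rs. f (map2 (\<otimes>) w rs))"

definition homotopy :: "nat \<Rightarrow> 'a list \<Rightarrow> 'e" where
  "homotopy k w = mean (shifts k (length w)) (\<lambda>rs. prism (map2 (\<lambda>y r. (y, y \<otimes> r)) w rs) f)"

lemma finite_shifts [simp]: "finite (set_pmf (shifts k m))"
  unfolding shifts_def by (rule finite_sequence_pmf) auto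

lemma shifts_D: "rs \<in> set_pmf (shifts k m) \<Longrightarrow> length rs = m \<and> set rs \<subseteq> carrier G"
  by (auto simp: shifts_def set_sequence_pmf list_all2_conv_all_nth in_set_conv_nth) (metis tail_carrier)

text \<open>A single leaf followed by the tail is a random right translate of that leaf, so the
  lowest level of the martingale is the limit of the averaged cocycle.\<close>

lemma M_approx_blur: "set ys \<subseteq> carrier G \<Longrightarrow> M_approx 0 k (map Leaf ys) = blur k ys"
proof -
  have "law 0 k (Leaf y) = map_pmf ((\<otimes>) y) (tail k 0)" for y
    by (simp add: law_def bind_return_pmf)
  then show ?thesis
    by (simp add: M_approx_def blur_def comp_def sequence_map2 mean_map shifts_def finite_sequence_pmf)
qed

lemma map2_translate:
  assumes "g \<in> carrier G" "set w \<subseteq> carrier G" "set rs \<subseteq> carrier G"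
  shows "map2 (\<otimes>) (map ((\<otimes>) g) w) rs = map ((\<otimes>) g) (map2 (\<otimes>) w rs)"
    and "map2 (\<lambda>y r. (y, y \<otimes> r)) (map ((\<otimes>) g) w) rs
      = map (map_prod ((\<otimes>) g) ((\<otimes>) g)) (map2 (\<lambda>y r. (y, y \<otimes> r)) w rs)"
  using assms by (auto simp: zip_map1 intro!: m_assoc) (blast dest: set_zip_leftD set_zip_rightD)+

lemma map2_closed:
  assumes "set w \<subseteq> carrier G" "set rs \<subseteq> carrier G"
  shows "set (map2 (\<otimes>) w rs) \<subseteq> carrier G"
  using assms by (auto intro!: m_closed) (blast dest: set_zip_leftD set_zip_rightD)+

lemma blur_equivariant:
  assumes g: "g \<in> carrier G" and w: "w \<in> tuples G n"
  shows "blur k (map ((\<otimes>) g) w) = act g (blur k w)"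
proof -
  have w': "length w = Suc n" "set w \<subseteq> carrier G" using w by (auto simp: tuples_def)
  have "blur k (map ((\<otimes>) g) w) = mean (shifts k (length w)) (\<lambda>rs. act g (f (map2 (\<otimes>) w rs)))"
    unfolding blur_def length_map
  proof (rule mean_cong)
    fix rs assume "rs \<in> set_pmf (shifts k (length w))"
    then have rs: "length rs = length w" "set rs \<subseteq> carrier G" using shifts_D by blast+
    have "map2 (\<otimes>) w rs \<in> tuples G n"
      using map2_closed[OF w'(2) rs(2)] w' rs by (simp add: tuples_def)
    then show "f (map2 (\<otimes>) (map ((\<otimes>) g) w) rs) = act g (f (map2 (\<otimes>) w rs))"
      unfolding map2_translate[OF g w'(2) rs(2)] by (rule f_equivariant[OF g])
  qed
  then show ?thesis by (simp add: blur_def mean_linear[OF act_linear[OF g]])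
qed

lemma pairs_closed:
  assumes "set w \<subseteq> carrier G" "set rs \<subseteq> carrier G"
  shows "fst ` set (map2 (\<lambda>y r. (y, y \<otimes> r)) w rs) \<union> snd ` set (map2 (\<lambda>y r. (y, y \<otimes> r)) w rs) \<subseteq> carrier G"
proof -
  have "y \<in> carrier G \<and> r \<in> carrier G" if "(y, r) \<in> set (zip w rs)" for y r
    using assms set_zip_leftD[OF that] set_zip_rightD[OF that] by blast
  then show ?thesis by auto
qed

lemma homotopy_equivariant:
  assumes g: "g \<in> carrier G" and w: "length w = n" "set w \<subseteq> carrier G"
  shows "homotopy k (map ((\<otimes>) g) w) = act g (homotopy k w)"
proof -
  have "homotopy k (map ((\<otimes>) g) w)
      = mean (shifts k (length w)) (\<lambda>rs. act g (prism (map2 (\<lambda>y r. (y, y \<otimes> r)) w rs) f))"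
    unfolding homotopy_def length_map
  proof (rule mean_cong)
    fix rs assume "rs \<in> set_pmf (shifts k (length w))"
    then have rs: "length rs = length w" "set rs \<subseteq> carrier G" using shifts_D by blast+
    let ?ps = "map2 (\<lambda>y r. (y, y \<otimes> r)) w rs"
    have "prism ?ps (\<lambda>v. f (map ((\<otimes>) g) v)) = prism ?ps (\<lambda>v. act g (f v))"
    proof (rule prism_cong)
      fix v assume v: "length v = Suc (length ?ps)" "set v \<subseteq> fst ` set ?ps \<union> snd ` set ?ps"
      have "set v \<subseteq> carrier G" using v(2) pairs_closed[OF w(2) rs(2)] by (rule order_trans)
      then have "v \<in> tuples G n" using v(1) w rs by (simp add: tuples_def)
      then show "f (map ((\<otimes>) g) v) = act g (f v)" by (rule f_equivariant[OF g])
    qed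
    then show "prism (map2 (\<lambda>y r. (y, y \<otimes> r)) (map ((\<otimes>) g) w) rs) f = act g (prism ?ps f)"
      by (simp only: map2_translate[OF g w(2) rs(2)] prism_map prism_linear[OF act_linear[OF g]])
  qed
  then show ?thesis by (simp add: homotopy_def mean_linear[OF act_linear[OF g]])
qed

lemma alt_sum_blur:
  assumes "xs \<in> tuples G (Suc n)"
  shows "alt_sum xs (blur k) = 0"
proof -
  have xs: "length xs = Suc (Suc n)" "set xs \<subseteq> carrier G" using assms by (auto simp: tuples_def)
  have "alt_sum xs (blur k) = mean (shifts k (length xs)) (\<lambda>rs. alt_sum (map2 (\<otimes>) xs rs) f)"
    unfolding blur_def[abs_def] shifts_def by (rule alt_sum_mean_sequence) simp
  also have "\<dots> = mean (shifts k (length xs)) (\<lambda>rs. 0)"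
  proof (rule mean_cong)
    fix rs assume "rs \<in> set_pmf (shifts k (length xs))"
    then have rs: "length rs = length xs" "set rs \<subseteq> carrier G" using shifts_D by blast+
    show "alt_sum (map2 (\<otimes>) xs rs) f = 0"
      using map2_closed[OF xs(2) rs(2)] xs rs by (intro f_cocycle) (simp add: tuples_def)
  qed
  finally show ?thesis by simp
qed

lemma alt_sum_homotopy:
  assumes "xs \<in> tuples G n"
  shows "alt_sum xs (homotopy k) = blur k xs - f xs"
proof -
  have xs: "length xs = Suc n" "set xs \<subseteq> carrier G" using assms by (auto simp: tuples_def)
  let ?ps = "\<lambda>rs. map2 (\<lambda>y r. (y, y \<otimes> r)) xs rs"
  have "alt_sum xs (homotopy k) = mean (shifts k (length xs)) (\<lambda>rs. alt_sum (?ps rs) (\<lambda>qs. prism qs f))"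
    unfolding homotopy_def[abs_def] shifts_def by (rule alt_sum_mean_sequence) simp
  also have "\<dots> = mean (shifts k (length xs)) (\<lambda>rs. f (map2 (\<otimes>) xs rs) - f xs)"
  proof (rule mean_cong)
    fix rs assume "rs \<in> set_pmf (shifts k (length xs))"
    then have rs: "length rs = length xs" "set rs \<subseteq> carrier G" using shifts_D by blast+
    have "prism (?ps rs) (\<lambda>w. alt_sum w f) = prism (?ps rs) (\<lambda>_. 0)"
    proof (rule prism_cong)
      fix v assume v: "length v = Suc (length (?ps rs))" "set v \<subseteq> fst ` set (?ps rs) \<union> snd ` set (?ps rs)"
      have "set v \<subseteq> carrier G" using v(2) pairs_closed[OF xs(2) rs(2)] by (rule order_trans)
      then show "alt_sum v f = 0" using v(1) xs rs by (intro f_cocycle) (simp add: tuples_def)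
    qed
    moreover have "map fst (?ps rs) = xs" "map snd (?ps rs) = map2 (\<otimes>) xs rs"
      using rs by (simp_all add: comp_def case_prod_unfold)
    ultimately show "alt_sum (?ps rs) (\<lambda>qs. prism qs f) = f (map2 (\<otimes>) xs rs) - f xs"
      using prism_homotopy[of "?ps rs" f] by (simp add: prism_zero)
  qed
  finally show ?thesis by (simp add: mean_diff blur_def)
qed

lemma norm_homotopy_le: "norm (homotopy k w) \<le> real (length w) * C"
proof -
  have "norm (prism (map2 (\<lambda>y r. (y, y \<otimes> r)) w rs) f) \<le> real (length w) * C"
    if "rs \<in> set_pmf (shifts k (length w))" for rs
    using norm_prism_le[of f C "map2 (\<lambda>y r. (y, y \<otimes> r)) w rs"] norm_f shifts_D[OF that] by simp
  then show ?thesis unfolding homotopy_def by (intro norm_mean_le) auto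
qed

text \<open>On tuples from \<open>S\<close> the averaged cocycle tends to a constant
  \<open>c\<close>, and the limit \<open>b\<close> of the homotopies has coboundary
  \<open>c - f\<close> there. So \<open>c - b\<close> is a primitive as soon as \<open>c\<close> is
  fixed by \<open>S\<close> and is its own coboundary.\<close>

theorem local_primitive:
  fixes d :: "nat \<Rightarrow> 'e"
  assumes dense: "closure (range d) = UNIV"
  shows "\<exists>b. (\<forall>w. norm (b w) \<le> (1 + real (length w)) * C) \<and>
    (\<forall>xs\<in>tuples G n. set xs \<subseteq> S \<longrightarrow> alt_sum xs b = f xs) \<and>
    (\<forall>g\<in>S. \<forall>w. length w = n \<longrightarrow> set w \<subseteq> carrier G \<longrightarrow> b (map ((\<otimes>) g) w) = act g (b w))"
proof -
  interpret self_similar_martingale T forest "map2 Node" M C by (rule martingale)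
  define ones where "ones = replicate (Suc n) \<one>"
  define c where "c = M 0 (map Leaf ones)"
  have ones: "ones \<in> tuples G n" "set ones \<subseteq> S" using one_S by (auto simp: ones_def tuples_def)
  have const: "M 0 (map Leaf ys) = c" if "length ys = Suc n" "set ys \<subseteq> S" for ys
  proof -
    have "map Leaf zs \<in> set_pmf (forest 0)" if "length zs = Suc n" "set zs \<subseteq> S" for zs
      using that S_fin S_ne by (auto simp: forest_def set_sequence_pmf list_all2_conv_all_nth subset_iff simp del: replicate_Suc)
    from this[OF that] this[of ones] ones show ?thesis
      unfolding c_def by (intro constant_if_separable[OF dense]) (auto simp: tuples_def)
  qed
  have blur_lim: "weak_star_to (\<lambda>k. blur k ys) c" if "length ys = Suc n" "set ys \<subseteq> S" for ys
  proof -
    have "set ys \<subseteq> carrier G" using that S_sub by blast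
    then show ?thesis using M(2)[of 0 "map Leaf ys"] const[OF that] by (simp add: M_approx_blur)
  qed
  have "\<exists>v. norm v \<le> real (length w) * C \<and> weak_star_to (\<lambda>k. homotopy k w) v" for w
    by (rule weak_star_limit[OF U(2,3) norm_homotopy_le])
  then obtain b where b: "\<And>w. norm (b w) \<le> real (length w) * C" "\<And>w. weak_star_to (\<lambda>k. homotopy k w) (b w)"
    by metis
  \<comment> \<open>The tuples with all entries \<one> and all entries \<open>g\<close> both lie
    over \<open>S\<close>, so the averages at them have the same limit \<open>c\<close>, while
    equivariance relates them by \<open>g\<close>.\<close>
  have c_inv: "act g c = c" if g: "g \<in> S" for g
  proof (rule weak_star_limit_unique[OF U(2)])
    have gc: "g \<in> carrier G" using g S_sub by blast
    show "((\<lambda>k. blinfun_apply (T (act g (blur k ones))) \<phi>) \<longlongrightarrow> blinfun_apply (T (act g c)) \<phi>) U" for \<phi>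
      using blur_lim[of ones] ones gc by (intro act_weak_star_limit) (auto simp: ones_def)
    have g_ones: "map ((\<otimes>) g) ones = replicate (Suc n) g" using gc by (simp add: ones_def)
    have "set (replicate (Suc n) g) \<subseteq> S" using g by auto
    from blur_lim[OF length_replicate this] show "((\<lambda>k. blinfun_apply (T (blur k (map ((\<otimes>) g) ones))) \<phi>) \<longlongrightarrow> blinfun_apply (T c) \<phi>) U" for \<phi>
      unfolding g_ones by blast
    show "eventually (\<lambda>k. act g (blur k ones) = blur k (map ((\<otimes>) g) ones)) U"
      by (simp add: blur_equivariant[OF gc ones(1)])
  qed
  \<comment> \<open>With an even number of faces a constant has coboundary 0, so \<open>c\<close>
    itself must vanish: the cocycle identity at the tuple of \<open>Suc (Suc n)\<close> ones, an odd
    number of equal faces, gives \<open>blur k ones = 0\<close>.\<close>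
  have alt_c: "alt_sum xs (\<lambda>_. c) = c" if "length xs = Suc n" for xs :: "'a list"
  proof (cases "odd (Suc n)")
    case True
    then show ?thesis using that by (simp add: alt_sum_const)
  next
    case False
    define zs where "zs = replicate (Suc (Suc n)) \<one>"
    have "omit i zs = ones" if "i < length zs" for i
      using that by (intro nth_equalityI) (auto simp: omit_def zs_def ones_def nth_append simp del: replicate_Suc)
    then have *: "alt_sum zs (blur k) = alt_sum zs (\<lambda>_. blur k ones)" for k
      by (intro alt_sum_cong) auto
    have "zs \<in> tuples G (Suc n)" by (auto simp: zs_def tuples_def)
    then have "blur k ones = 0" for k
      using alt_sum_blur[of zs k] * False by (simp add: alt_sum_const zs_def)
    then have "c = 0"
      using blur_lim[of ones] ones
      by (intro weak_star_limit_unique[OF U(2), of "\<lambda>k. blur k ones" c "\<lambda>_. 0"]) (auto simp: ones_def)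
    then show ?thesis by (simp add: alt_sum_const)
  qed
  have alt_b: "alt_sum xs b = c - f xs" if xs: "xs \<in> tuples G n" "set xs \<subseteq> S" for xs
  proof (rule weak_star_limit_unique[OF U(2)])
    show "((\<lambda>k. blinfun_apply (T (alt_sum xs (homotopy k))) \<phi>) \<longlongrightarrow> blinfun_apply (T (alt_sum xs b)) \<phi>) U" for \<phi>
      using b(2) by (intro weak_star_limit_alt_sum) blast
    show "((\<lambda>k. blinfun_apply (T (blur k xs - f xs)) \<phi>) \<longlongrightarrow> blinfun_apply (T (c - f xs)) \<phi>) U" for \<phi>
      unfolding T_diff blinfun.diff_left using blur_lim[of xs] xs
      by (intro tendsto_diff tendsto_const) (auto simp: tuples_def)
    show "eventually (\<lambda>k. alt_sum xs (homotopy k) = blur k xs - f xs) U"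
      by (simp add: alt_sum_homotopy[OF xs(1)])
  qed
  have b_inv: "b (map ((\<otimes>) g) w) = act g (b w)" if g: "g \<in> carrier G" and w: "length w = n" "set w \<subseteq> carrier G" for g w
  proof (rule weak_star_limit_unique[OF U(2)])
    show "((\<lambda>k. blinfun_apply (T (homotopy k (map ((\<otimes>) g) w))) \<phi>) \<longlongrightarrow> blinfun_apply (T (b (map ((\<otimes>) g) w))) \<phi>) U" for \<phi>
      using b(2) by blast
    show "((\<lambda>k. blinfun_apply (T (act g (homotopy k w))) \<phi>) \<longlongrightarrow> blinfun_apply (T (act g (b w))) \<phi>) U" for \<phi>
      using b(2) by (intro act_weak_star_limit[OF g]) blast
    show "eventually (\<lambda>k. homotopy k (map ((\<otimes>) g) w) = act g (homotopy k w)) U"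
      by (simp add: homotopy_equivariant[OF g w])
  qed
  define b' where "b' = (\<lambda>w. c - b w)"
  have "norm (b' w) \<le> (1 + real (length w)) * C" for w
    using norm_triangle_ineq4[of c "b w"] b(1)[of w] M(1)[of 0 "map Leaf ones"]
    by (simp add: b'_def c_def algebra_simps)
  moreover have "alt_sum xs b' = f xs" if "xs \<in> tuples G n" "set xs \<subseteq> S" for xs
    using that alt_b alt_c by (simp add: b'_def alt_sum_diff tuples_def)
  moreover have "b' (map ((\<otimes>) g) w) = act g (b' w)" if "g \<in> S" "length w = n" "set w \<subseteq> carrier G" for g w
  proof -
    have gc: "g \<in> carrier G" using that S_sub by blast
    show ?thesis using that b_inv[OF gc] c_inv by (simp add: b'_def linear_diff[OF act_linear[OF gc]])
  qed
  ultimately show ?thesis by blast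
qed

end

section \<open>From finite sets to the whole group\<close>

lemma (in isometric_dual_module) cocycle_bounded_coboundary:
  fixes d :: "nat \<Rightarrow> 'e"
  assumes ac: "algebraically_closed G" and dense: "closure (range d) = UNIV"
    and f: "f \<in> bounded_cocycles G act (Suc m)"
  shows "f \<in> bounded_coboundaries G act (Suc m)"
proof -
  have f_bdd: "bounded (f ` tuples G (Suc m))" and f_off: "\<And>xs. xs \<notin> tuples G (Suc m) \<Longrightarrow> f xs = 0"
    and f_inv: "\<And>g. g \<in> carrier G \<Longrightarrow> cochain_act G act (Suc m) g f = f"
    and df: "coboundary G (Suc m) f = (\<lambda>_. 0)"
    using f by (auto simp: bounded_cocycles_def kernel_def invariant_cochains_def bounded_cochains_def)
  obtain C where C: "norm (f xs) \<le> C" for xs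
  proof -
    obtain B where "\<And>xs. xs \<in> tuples G (Suc m) \<Longrightarrow> norm (f xs) \<le> B"
      using f_bdd by (auto simp: bounded_iff)
    then have "norm (f xs) \<le> max B 0" for xs
      using f_off[of xs] by (cases "xs \<in> tuples G (Suc m)") (auto intro: max.coboundedI1)
    then show thesis using that by blast
  qed
  have C0: "0 \<le> C" using order_trans[OF norm_ge_zero C] .
  have cancel: "map ((\<otimes>) (inv g)) (map ((\<otimes>) g) xs) = xs" "map ((\<otimes>) g) (map ((\<otimes>) (inv g)) xs) = xs"
    if "g \<in> carrier G" "set xs \<subseteq> carrier G" for g xs
    using that by (auto simp: subset_iff simp flip: m_assoc intro!: map_idI)
  have f_equivariant: "f (map ((\<otimes>) g) xs) = act g (f xs)" if g: "g \<in> carrier G" and xs: "xs \<in> tuples G (Suc m)" for g xs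
    using fun_cong[OF f_inv[OF g], of "map ((\<otimes>) g) xs"] tuples_translate[OF is_group g xs] cancel(1)[OF g] xs
    by (simp add: cochain_act_def tuples_def del: map_map)
  have f_cocycle: "alt_sum xs f = 0" if "xs \<in> tuples G (Suc (Suc m))" for xs
    using fun_cong[OF df, of xs] coboundary_alt_sum[OF that, of f] by simp
  \<comment> \<open>For infinite \<open>S\<close> only the norm bound is asked: a weak-* limit needs
    a bound for every index, and the zero function then provides it.\<close>
  define good where "good = (\<lambda>S b. (\<forall>w. norm (b w) \<le> (1 + real (length w)) * C) \<and> (finite S \<longrightarrow>
    (\<forall>xs\<in>tuples G (Suc m). set xs \<subseteq> S \<longrightarrow> alt_sum xs b = f xs) \<and>
    (\<forall>g\<in>S \<inter> carrier G. \<forall>w\<in>tuples G m. b (map ((\<otimes>) g) w) = act g (b w))))"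
  have "\<exists>b. good S b" for S
  proof (cases "finite S")
    case True
    \<comment> \<open>\<open>S\<close> ranges over the finite subsets of the type, hence the
      intersection; \<one> is added for the constant tuple of ones.\<close>
    define S' where "S' = insert \<one> (S \<inter> carrier G)"
    have "finite S'" "S' \<noteq> {}" "S' \<subseteq> carrier G" using True by (auto simp: S'_def)
    then obtain t where t: "commuting_involutions G S' t"
      using algebraically_closed_commuting_involutions[OF ac] by blast
    obtain U :: "nat filter" where U: "U \<le> sequentially" "U \<noteq> bot"
        "\<And>P. eventually P U \<or> eventually (\<lambda>x. \<not> P x) U"
      using ex_ultrafilter[of sequentially] by auto
    have "randomized_cocycle G act T act' S' t (Suc m) f C U"
      using U f_equivariant f_cocycle C
      by (intro randomized_cocycle.intro isometric_dual_module_axioms t randomized_cocycle_axioms.intro)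
         (auto simp: S'_def)
    from randomized_cocycle.local_primitive[OF this dense] obtain b where
        b: "\<forall>w. norm (b w) \<le> (1 + real (length w)) * C"
        "\<forall>xs\<in>tuples G (Suc m). set xs \<subseteq> S' \<longrightarrow> alt_sum xs b = f xs"
        "\<forall>g\<in>S'. \<forall>w. length w = Suc m \<longrightarrow> set w \<subseteq> carrier G \<longrightarrow> b (map ((\<otimes>) g) w) = act g (b w)" by blast
    have "set xs \<subseteq> S'" if "xs \<in> tuples G (Suc m)" "set xs \<subseteq> S" for xs
      using that by (auto simp: tuples_def S'_def)
    then have "good S b" using b unfolding good_def by (auto simp: tuples_def S'_def)
    then show ?thesis by blast
  next
    case False
    then have "good S (\<lambda>_. 0)" using C0 by (simp add: good_def)
    then show ?thesis by blast
  qed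
  then obtain b where b: "\<And>S. good S (b S)" by metis
  have b_norm: "norm (b S w) \<le> (1 + real (length w)) * C" for S w
    using b[of S] by (simp add: good_def)
  obtain U where U: "U \<le> finite_subsets_at_top (UNIV :: 'a set)" "U \<noteq> bot"
      "\<And>P. eventually P U \<or> eventually (\<lambda>x. \<not> P x) U"
    using ex_ultrafilter[of "finite_subsets_at_top (UNIV :: 'a set)"] by auto
  \<comment> \<open>Each identity wanted of the limit involves finitely many group elements, so it
    already holds for \<open>b S\<close> with \<open>S\<close> large.\<close>
  have ev: "eventually (\<lambda>S. finite S \<and> A \<subseteq> S) U" if "finite A" for A
    by (rule filter_leD[OF U(1)]) (use that in \<open>auto simp: eventually_finite_subsets_at_top\<close>)
  have "\<exists>v. norm v \<le> (1 + real (length w)) * C \<and>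
      (\<forall>\<phi>. ((\<lambda>S. blinfun_apply (T (b S w)) \<phi>) \<longlongrightarrow> blinfun_apply (T v) \<phi>) U)" for w
    by (rule weak_star_limit[OF U(2,3) b_norm])
  then obtain \<beta> where \<beta>: "\<And>w. norm (\<beta> w) \<le> (1 + real (length w)) * C"
      "\<And>w \<phi>. ((\<lambda>S. blinfun_apply (T (b S w)) \<phi>) \<longlongrightarrow> blinfun_apply (T (\<beta> w)) \<phi>) U"
    by metis
  have \<beta>_equivariant: "\<beta> (map ((\<otimes>) g) w) = act g (\<beta> w)" if g: "g \<in> carrier G" and w: "w \<in> tuples G m" for g w
  proof (rule weak_star_limit_unique[OF U(2) \<beta>(2) act_weak_star_limit[OF g \<beta>(2)]])
    show "eventually (\<lambda>S. b S (map ((\<otimes>) g) w) = act g (b S w)) U"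
      using ev[OF finite.insertI[OF finite.emptyI, of g]]
    proof eventually_elim
      case (elim S)
      then show ?case using b[of S] g w unfolding good_def by blast
    qed
  qed
  have \<beta>_primitive: "alt_sum xs \<beta> = f xs" if xs: "xs \<in> tuples G (Suc m)" for xs
  proof (rule weak_star_limit_unique[OF U(2) weak_star_limit_alt_sum[OF \<beta>(2)] tendsto_const])
    show "eventually (\<lambda>S. alt_sum xs (b S) = f xs) U"
      using ev[OF finite_set, of xs]
    proof eventually_elim
      case (elim S)
      then show ?case using b[of S] xs unfolding good_def by blast
    qed
  qed
  define h where "h = (\<lambda>xs. if xs \<in> tuples G m then \<beta> xs else 0)"
  have "norm (h xs) \<le> (1 + real (Suc m)) * C" if "xs \<in> tuples G m" for xs
    using \<beta>(1)[of xs] that by (simp add: h_def tuples_def)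
  then have "bounded (h ` tuples G m)" by (intro boundedI) auto
  moreover have "cochain_act G act m g h = h" if g: "g \<in> carrier G" for g
  proof
    fix xs
    show "cochain_act G act m g h xs = h xs"
    proof (cases "xs \<in> tuples G m")
      case True
      have "map ((\<otimes>) (inv g)) xs \<in> tuples G m" using tuples_translate[OF is_group _ True, of "inv g"] g by simp
      moreover from \<beta>_equivariant[OF g this] have "act g (\<beta> (map ((\<otimes>) (inv g)) xs)) = \<beta> xs"
        using cancel(2)[OF g, of xs] True by (simp add: tuples_def del: map_map)
      ultimately show ?thesis using True by (simp add: cochain_act_def h_def)
    qed (simp add: cochain_act_def h_def)
  qed
  ultimately have "h \<in> carrier (invariant_cochains G act m)"
    by (auto simp: invariant_cochains_def bounded_cochains_def h_def)
  moreover have "f = coboundary G m h"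
  proof
    fix xs
    show "f xs = coboundary G m h xs"
    proof (cases "xs \<in> tuples G (Suc m)")
      case True
      have "alt_sum xs h = alt_sum xs \<beta>"
        using True by (intro alt_sum_cong) (simp add: h_def omit_tuples tuples_def[of G "Suc m"] less_Suc_eq_le)
      then show ?thesis using True by (simp add: coboundary_alt_sum \<beta>_primitive)
    qed (simp add: f_off coboundary_def)
  qed
  ultimately show ?thesis by simp
qed

lemma (in banach_module) trivial_bounded_cohomologyI:
  assumes "bounded_cocycles G act (Suc m) \<subseteq> bounded_coboundaries G act (Suc m)"
  shows "trivial_group (bounded_cohomology G act (Suc m))"
proof -
  interpret C: comm_group "invariant_cochains G act (Suc m)" by (rule comm_group_invariant_cochains)
  have "group_hom (invariant_cochains G act m) (invariant_cochains G act (Suc m)) (coboundary G m)"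
    using comm_group_invariant_cochains coboundary_hom
    by (auto simp: group_hom_def group_hom_axioms_def comm_group_def)
  then have sub: "subgroup (bounded_coboundaries G act (Suc m)) (invariant_cochains G act (Suc m))"
    using group_hom.img_is_subgroup by fastforce
  have "bounded_coboundaries G act (Suc m) #>\<^bsub>invariant_cochains G act (Suc m)\<^esub> z = bounded_coboundaries G act (Suc m)"
    if "z \<in> bounded_cocycles G act (Suc m)" for z
    using that assms sub subgroup.mem_carrier[OF sub] by (intro C.coset_join2) auto
  then have "carrier (bounded_cohomology G act (Suc m)) \<subseteq> {\<one>\<^bsub>bounded_cohomology G act (Suc m)\<^esub>}"
    by (auto simp: bounded_cohomology_def FactGroup_def RCOSETS_def r_coset_def)
  moreover have "group (bounded_cohomology G act (Suc m))"
    using comm_group_bounded_cohomology by (simp add: comm_group_def)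
  ultimately show ?thesis
    by (auto simp: trivial_group_def dest: group.is_monoid monoid.one_closed)
qed

theorem corollary1p19:
  fixes G :: "('a, 'm) monoid_scheme"
  assumes "algebraically_closed G"
  shows "Xsep_boundedly_acyclic TYPE('e::banach) TYPE('f::banach) G"
  unfolding Xsep_boundedly_acyclic_def
proof (intro allI impI)
  fix act :: "'a \<Rightarrow> 'e \<Rightarrow> 'e" and n :: nat
  assume dual: "dual_module TYPE('f) G act" and sep: "separable_space (euclidean :: 'e topology)" and n: "1 \<le> n"
  obtain act' :: "'a \<Rightarrow> 'f \<Rightarrow> 'f" and T where "isometric_dual_module G act T act'"
    using dual unfolding dual_module_def isometric_dual_module_def isometric_dual_module_axioms_def isometric_duality_def
    by blast
  then interpret isometric_dual_module G act T act' .
  obtain D :: "'e set" where D: "countable D" "closure D = UNIV"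
    using sep by (auto simp: separable_space_def)
  then have "D \<noteq> {}" by auto
  then have dense: "closure (range (from_nat_into D)) = UNIV" using D by (simp add: range_from_nat_into)
  obtain m where "n = Suc m" using n by (cases n) auto
  then show "trivial_group (bounded_cohomology G act n)"
    using cocycle_bounded_coboundary[OF assms dense] by (auto intro!: trivial_bounded_cohomologyI)
qed

end
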